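(* Let $T>0$ and let $\mathbf{BL}:\mathbb{R}^N\times[0,T]\to\mathcal{P}(\mathbb{R}^{N+1})$ be a set-valued map satisfying $(\mathbf{H}_{\mathbf{BL}})$. Let $\mathbb{M}=(\mathbf{M}^k)_{k=0..N}$ be a regular stratification of $\mathbb{R}^N$ adapted to $\mathbf{BL}$, and assume that (TC-BL) and (NC-BL) hold. Let $g:\mathbb{R}^N\to\mathbb{R}$ be bounded and uniformly continuous and let $U$ be the associated value function. Then: (i) for any $k=0,\dots,N-1$, $U^*=(U|_{\mathbf{M}^k})^*$ on $\mathbf{M}^k$; that is, at every $(x,t)$ with $x\in\mathbf{M}^k$, $t\in(0,T]$, the upper semicontinuous envelope $U^*(x,t)=\limsup_{(y,s)\to(x,t)}U(y,s)$ equals the same limsup taken only over points $(y,s)\to(x,t)$ with $y\in\mathbf{M}^k$; (ii) for any $k=0,\dots,N-1$, $U$ is a viscosity subsolution of $U_t+H^k(x,t,DU)=0$ on $\mathbf{M}^k\times(0,T)$; that is, if $\phi$ is a smooth function on $\mathbb{R}^N\times(0,T)$ and $(x,t)\in\mathbf{M}^k\times(0,T)$ is a local maximum point of $U^*-\phi$ on $\mathbf{M}^k\times(0,T)$, then $$\phi_t(x,t)+H^k(x,t,D\phi(x,t))\le 0.$$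
   Context: **Assumption $(\mathbf{H}_{\mathbf{BL}})$.** $\mathbf{BL}:\mathbb{R}^N\times[0,T]\to\mathcal{P}(\mathbb{R}^{N+1})$ has compact convex images and is upper semicontinuous (for every open $\mathcal{O}\supset\mathbf{BL}(x_0,t_0)$ there is a neighborhood $\omega$ of $(x_0,t_0)$ with $\mathbf{BL}(\omega)\subset\mathcal{O}$), and there is $M>0$ with $\mathbf{BL}(x,t)\subset\{(b,l)\in\mathbb{R}^N\times\mathbb{R}:|b|\le M,\ |l|\le M\}$ for all $(x,t)$. Set $\mathbf{B}(x,t)=\{b\in\mathbb{R}^N:\exists\, l,\ (b,l)\in\mathbf{BL}(x,t)\}$. **Value function.** For $(x,t)\in\mathbb{R}^N\times(0,T]$, $\mathcal{T}(x,t)$ is the set of Lipschitz functions $(X,L):[0,t]\to\mathbb{R}^N\times\mathbb{R}$ with $(X,L)(0)=(x,0)$ and $(\dot X,\dot L)(s)\in\mathbf{BL}(X(s),t-s)$ for a.e. $s$. One writes $\dot X(s)=b(X(s),t-s)$, $\dot L(s)=l(X(s),t-s)$ for the corresponding selection. The value function is $$U(x,t)=\inf_{(X,L)\in\mathcal{T}(x,t)}\Big\{\int_0^t l(X(s),t-s)\,ds+g(X(t))\Big\}.$$ **Admissible Flat Stratification (AFS).** Let $O\subset\mathbb{R}^N$ be open and $O=\mathbf{M}^0\cup\dots\cup\mathbf{M}^N$ with the $\mathbf{M}^k$ pairwise disjoint submanifolds (closures are relative to $O$). This is an AFS of $O$ if: (i) for any $x\in\mathbf{M}^k$ there are $r>0$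 and a $k$-dimensional linear subspace $V_k$ with $B(x,r)\cap\mathbf{M}^k=B(x,r)\cap(x+V_k)$, and $B(x,r)\cap\mathbf{M}^l=\emptyset$ if $l<k$; (ii) if $\mathbf{M}^k\cap\overline{\mathbf{M}^l}\ne\emptyset$ for some $l>k$ then $\mathbf{M}^k\subset\overline{\mathbf{M}^l}$; (iii) $\overline{\mathbf{M}^k}\subset\mathbf{M}^0\cup\dots\cup\mathbf{M}^k$. **Regular stratification.** $\mathbb{M}=(\mathbf{M}^k)_{k=0..N}$ is a regular stratification of $\mathbb{R}^N$ if $\mathbb{R}^N=\mathbf{M}^0\cup\dots\cup\mathbf{M}^N$ (disjoint union) and for any $x\in\mathbb{R}^N$ there are $r=r(x)>0$ and a $C^{1,1}$ change of coordinates $\Psi^x:B(x,r)\to\mathbb{R}^N$ such that the sets $\Psi^x(\mathbf{M}^k\cap B(x,r))$ form an AFS of $\Psi^x(B(x,r))$. $T_x\mathbf{M}^k\subset\mathbb{R}^N$ denotes the ($k$-dimensional, linear) tangent space to $\mathbf{M}^k$ at $x\in\mathbf{M}^k$; $T_x\mathbf{M}^0=\{0\}$. **Adapted.** $\mathbb{M}$ is adapted to $\mathbf{BL}$ if for every $k$ the map $(x,t)\mapsto\mathbf{BL}(x,t)\cap(T_x\mathbf{M}^k\times\mathbb{R})$ is continuous on $\mathbf{M}^k\times[0,T]$ for the Hausdorff distance. **Tangential Hamiltonians.** For $x\in\mathbf{M}^k$, $t\in[0,T]$, $p\in\mathbb{R}^N$: $H^k(x,t,p)=\sup\{-b\cdot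 p-l:(b,l)\in\mathbf{BL}(x,t),\ b\in T_x\mathbf{M}^k\}$ (it depends on $p$ only through its projection on $T_x\mathbf{M}^k$). **(TC-BL), (NC-BL).** When $\mathbb{M}$ is an AFS: for every $x$, with $x\in\mathbf{M}^k$ and $r,V_k$ as in (i) of AFS, there are $C_1>0$, $\delta>0$ and a modulus of continuity $m$ (with $m(0+)=0$) such that (TC-BL) for any $k\le j\le N$, $t,t'\in[0,T]$ and $y_1,y_2\in\mathbf{M}^j\cap B(x,r)$ with $y_1-y_2\in V_k$: $\mathrm{dist}_H(\mathbf{B}(y_1,t),\mathbf{B}(y_2,t))\le C_1|y_1-y_2|$ and $\mathrm{dist}_H(\mathbf{BL}(y_1,t),\mathbf{BL}(y_2,t'))\le m(|y_1-y_2|+|t-t'|)$, where $\mathrm{dist}_H$ is the Hausdorff distance; (NC-BL) if $k<N$, for any $t\in[0,T]$ and $y\in B(x,r)\setminus\mathbf{M}^k$: $B(0,\delta)\cap V_k^\perp\subset\mathbf{B}(y,t)\cap V_k^\perp$. For a general regular stratification these conditions are required, near each $x$, for the AFS $(\Psi^x(\mathbf{M}^k\cap B(x,r)))_k$ and the rectified map $\widetilde{\mathbf{BL}}(y,t)=\{(D\Psi^x(\chi(y))b,\,l):(b,l)\in\mathbf{BL}(\chi(y),t)\}$, $\chi=(\Psi^x)^{-1}$. *)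

theory Defs
  imports "HOL-Analysis.Analysis"
begin

(* The space R^N is a Euclidean space 'a with N = DIM('a), and R^(N+1) is 'a \<times> real.
   Sets of velocities and running costs are given by BL :: 'a \<Rightarrow> real \<Rightarrow> ('a \<times> real) set;
   only the values BL x t with 0 \<le> t \<le> T matter.  Stratifications are families
   M :: nat \<Rightarrow> 'a set of which only M 0, ..., M N matter. *)

subsection \<open>Set-valued maps\<close>

(* Infima and suprema are taken in ennreal, so that the distance between the empty set and
   a nonempty set is infinite. *)
definition hausdorff_dist :: "'a::metric_space set \<Rightarrow> 'a set \<Rightarrow> ennreal" where
  "hausdorff_dist A B =
     max (SUP a\<in>A. INF b\<in>B. ennreal (dist a b)) (SUP b\<in>B. INF a\<in>A. ennreal (dist a b))"

definition H_BL :: "real \<Rightarrow> ('a::euclidean_space \<Rightarrow> real \<Rightarrow> ('a \<times> real) set) \<Rightarrow> bool" where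
  "H_BL T BL \<longleftrightarrow>
     (\<forall>x. \<forall>t\<in>{0..T}. compact (BL x t) \<and> convex (BL x t)) \<and>
     (\<forall>x\<^sub>0. \<forall>t\<^sub>0\<in>{0..T}. \<forall>W. open W \<and> BL x\<^sub>0 t\<^sub>0 \<subseteq> W \<longrightarrow>
        (\<exists>\<omega>. open \<omega> \<and> (x\<^sub>0, t\<^sub>0) \<in> \<omega> \<and> (\<forall>(x, t)\<in>\<omega>. t \<in> {0..T} \<longrightarrow> BL x t \<subseteq> W))) \<and>
     (\<exists>K>0. \<forall>x. \<forall>t\<in>{0..T}. \<forall>(b, l)\<in>BL x t. norm b \<le> K \<and> \<bar>l\<bar> \<le> K)"

definition B_of :: "('a \<Rightarrow> real \<Rightarrow> ('a \<times> real) set) \<Rightarrow> 'a \<Rightarrow> real \<Rightarrow> 'a set" where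
  "B_of BL x t = {b. \<exists>l. (b, l) \<in> BL x t}"

subsection \<open>Value function\<close>

definition trajectories ::
  "('a::euclidean_space \<Rightarrow> real \<Rightarrow> ('a \<times> real) set) \<Rightarrow> 'a \<Rightarrow> real
     \<Rightarrow> ((real \<Rightarrow> 'a) \<times> (real \<Rightarrow> real)) set" where
  "trajectories BL x t = {(X, L).
     (\<exists>C. C-lipschitz_on {0..t} (\<lambda>s. (X s, L s))) \<and> X 0 = x \<and> L 0 = 0 \<and>
     (AE s\<in>{0..t} in lebesgue. \<exists>b l.
        (X has_vector_derivative b) (at s) \<and> (L has_real_derivative l) (at s) \<and>
        (b, l) \<in> BL (X s) (t - s))}"

(* The running cost l(X(s), t - s) is the derivative of L at s.  The infimum is taken in the
   extended reals. *)
definition value_fun ::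
  "('a::euclidean_space \<Rightarrow> real \<Rightarrow> ('a \<times> real) set) \<Rightarrow> ('a \<Rightarrow> real) \<Rightarrow> 'a \<times> real \<Rightarrow> ereal" where
  "value_fun BL g = (\<lambda>(x, t).
     INF (X, L)\<in>trajectories BL x t. ereal (integral {0..t} (\<lambda>s. deriv L s) + g (X t)))"

subsection \<open>Stratifications\<close>

definition flat_at :: "(nat \<Rightarrow> 'a::euclidean_space set) \<Rightarrow> nat \<Rightarrow> 'a \<Rightarrow> real \<Rightarrow> 'a set \<Rightarrow> bool" where
  "flat_at M k x r V \<longleftrightarrow>
     r > 0 \<and> subspace V \<and> dim V = k \<and> ball x r \<inter> M k = ball x r \<inter> (\<lambda>v. x + v) ` V \<and>
     (\<forall>l<k. ball x r \<inter> M l = {})"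

(* The closure of S relative to W is closure S \<inter> W.  That each M k is a submanifold is part
   of local flatness. *)
definition AFS :: "'a::euclidean_space set \<Rightarrow> (nat \<Rightarrow> 'a set) \<Rightarrow> bool" where
  "AFS W M \<longleftrightarrow>
     open W \<and> W = (\<Union>k\<le>DIM('a). M k) \<and> disjoint_family_on M {..DIM('a)} \<and>
     (\<forall>k\<le>DIM('a). \<forall>x\<in>M k. \<exists>r V. flat_at M k x r V) \<and>
     (\<forall>l\<le>DIM('a). \<forall>k<l. M k \<inter> (closure (M l) \<inter> W) \<noteq> {} \<longrightarrow> M k \<subseteq> closure (M l) \<inter> W) \<and>
     (\<forall>k\<le>DIM('a). closure (M k) \<inter> W \<subseteq> (\<Union>j\<le>k. M j))"

definition C11_on :: "'a::real_normed_vector set \<Rightarrow> ('a \<Rightarrow> 'b::real_normed_vector) \<Rightarrow> bool" where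
  "C11_on S f \<longleftrightarrow>
     (\<exists>f' :: 'a \<Rightarrow> 'a \<Rightarrow>\<^sub>L 'b. (\<forall>x\<in>S. (f has_derivative blinfun_apply (f' x)) (at x)) \<and>
        (\<exists>C. C-lipschitz_on S f'))"

definition C11_change_of_coordinates ::
  "'a::euclidean_space set \<Rightarrow> ('a \<Rightarrow> 'a) \<Rightarrow> bool" where
  "C11_change_of_coordinates S \<Psi> \<longleftrightarrow>
     open S \<and> open (\<Psi> ` S) \<and> inj_on \<Psi> S \<and> C11_on S \<Psi> \<and> C11_on (\<Psi> ` S) (inv_into S \<Psi>)"

definition rectified_strat ::
  "('a::euclidean_space \<Rightarrow> 'a) \<Rightarrow> 'a set \<Rightarrow> (nat \<Rightarrow> 'a set) \<Rightarrow> nat \<Rightarrow> 'a set" where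
  "rectified_strat \<Psi> S M k = \<Psi> ` (M k \<inter> S)"

definition strat_chart ::
  "(nat \<Rightarrow> 'a::euclidean_space set) \<Rightarrow> 'a \<Rightarrow> real \<Rightarrow> ('a \<Rightarrow> 'a) \<Rightarrow> bool" where
  "strat_chart M x r \<Psi> \<longleftrightarrow>
     r > 0 \<and> C11_change_of_coordinates (ball x r) \<Psi> \<and>
     AFS (\<Psi> ` ball x r) (rectified_strat \<Psi> (ball x r) M)"

definition regular_stratification :: "(nat \<Rightarrow> 'a::euclidean_space set) \<Rightarrow> bool" where
  "regular_stratification M \<longleftrightarrow>
     (\<Union>k\<le>DIM('a). M k) = UNIV \<and> disjoint_family_on M {..DIM('a)} \<and>
     (\<forall>x. \<exists>r \<Psi>. strat_chart M x r \<Psi>)"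

(* Velocities at x of C^1 curves drawn on S. *)
definition tangent_space :: "'a::euclidean_space set \<Rightarrow> 'a \<Rightarrow> 'a set" where
  "tangent_space S x = {v. \<exists>\<gamma> \<epsilon>. \<epsilon> > 0 \<and> \<gamma> C1_differentiable_on {-\<epsilon><..<\<epsilon>} \<and>
     \<gamma> ` {-\<epsilon><..<\<epsilon>} \<subseteq> S \<and> \<gamma> 0 = x \<and> (\<gamma> has_vector_derivative v) (at 0)}"

definition tangential_BL ::
  "('a::euclidean_space \<Rightarrow> real \<Rightarrow> ('a \<times> real) set) \<Rightarrow> 'a set \<Rightarrow> 'a \<Rightarrow> real \<Rightarrow> ('a \<times> real) set" where
  "tangential_BL BL S x t = BL x t \<inter> (tangent_space S x \<times> UNIV)"

definition adapted ::
  "real \<Rightarrow> (nat \<Rightarrow> 'a::euclidean_space set) \<Rightarrow> ('a \<Rightarrow> real \<Rightarrow> ('a \<times> real) set) \<Rightarrow> bool" where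
  "adapted T M BL \<longleftrightarrow>
     (\<forall>k\<le>DIM('a). \<forall>x\<in>M k. \<forall>t\<in>{0..T}.
        ((\<lambda>(y, s). hausdorff_dist (tangential_BL BL (M k) y s) (tangential_BL BL (M k) x t))
           \<longlongrightarrow> 0) (at (x, t) within M k \<times> {0..T}))"

definition tangential_hamiltonian ::
  "('a::euclidean_space \<Rightarrow> real \<Rightarrow> ('a \<times> real) set) \<Rightarrow> 'a set \<Rightarrow> 'a \<Rightarrow> real \<Rightarrow> 'a \<Rightarrow> ereal" where
  "tangential_hamiltonian BL S x t p = (SUP (b, l)\<in>tangential_BL BL S x t. ereal (- (b \<bullet> p) - l))"

subsection \<open>Tangential continuity and normal controllability\<close>

definition TC_BL_at ::
  "real \<Rightarrow> (nat \<Rightarrow> 'a::euclidean_space set) \<Rightarrow> ('a \<Rightarrow> real \<Rightarrow> ('a \<times> real) set)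
     \<Rightarrow> nat \<Rightarrow> 'a \<Rightarrow> real \<Rightarrow> 'a set \<Rightarrow> real \<Rightarrow> (real \<Rightarrow> real) \<Rightarrow> bool" where
  "TC_BL_at T M BL k x r V C\<^sub>1 m \<longleftrightarrow>
     (\<forall>j\<in>{k..DIM('a)}. \<forall>t\<in>{0..T}. \<forall>t'\<in>{0..T}.
        \<forall>y\<^sub>1\<in>M j \<inter> ball x r. \<forall>y\<^sub>2\<in>M j \<inter> ball x r. y\<^sub>1 - y\<^sub>2 \<in> V \<longrightarrow>
          hausdorff_dist (B_of BL y\<^sub>1 t) (B_of BL y\<^sub>2 t) \<le> ennreal (C\<^sub>1 * norm (y\<^sub>1 - y\<^sub>2)) \<and>
          hausdorff_dist (BL y\<^sub>1 t) (BL y\<^sub>2 t') \<le> ennreal (m (norm (y\<^sub>1 - y\<^sub>2) + \<bar>t - t'\<bar>)))"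

definition NC_BL_at ::
  "real \<Rightarrow> 'a::euclidean_space set \<Rightarrow> (nat \<Rightarrow> 'a set) \<Rightarrow> ('a \<Rightarrow> real \<Rightarrow> ('a \<times> real) set)
     \<Rightarrow> nat \<Rightarrow> 'a \<Rightarrow> real \<Rightarrow> 'a set \<Rightarrow> real \<Rightarrow> bool" where
  "NC_BL_at T W M BL k x r V \<delta> \<longleftrightarrow>
     (k < DIM('a) \<longrightarrow>
       (\<forall>t\<in>{0..T}. \<forall>y\<in>(ball x r \<inter> W) - M k.
          ball 0 \<delta> \<inter> orthogonal_comp V \<subseteq> B_of BL y t \<inter> orthogonal_comp V))"

definition AFS_TC_NC ::
  "real \<Rightarrow> 'a::euclidean_space set \<Rightarrow> (nat \<Rightarrow> 'a set) \<Rightarrow> ('a \<Rightarrow> real \<Rightarrow> ('a \<times> real) set) \<Rightarrow> bool" where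
  "AFS_TC_NC T W M BL \<longleftrightarrow>
     (\<forall>k\<le>DIM('a). \<forall>x\<in>M k. \<exists>r V C\<^sub>1 \<delta> m.
        flat_at M k x r V \<and> C\<^sub>1 > 0 \<and> \<delta> > 0 \<and> (\<forall>s\<ge>0. m s \<ge> 0) \<and> (m \<longlongrightarrow> 0) (at_right 0) \<and>
        TC_BL_at T M BL k x r V C\<^sub>1 m \<and> NC_BL_at T W M BL k x r V \<delta>)"

definition rectified_BL ::
  "('a::euclidean_space \<Rightarrow> 'a) \<Rightarrow> 'a set \<Rightarrow> ('a \<Rightarrow> real \<Rightarrow> ('a \<times> real) set)
     \<Rightarrow> 'a \<Rightarrow> real \<Rightarrow> ('a \<times> real) set" where
  "rectified_BL \<Psi> S BL y t =
     (let x = inv_into S \<Psi> y in {(frechet_derivative \<Psi> (at x) b, l) |b l. (b, l) \<in> BL x t})"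

definition TC_NC_BL ::
  "real \<Rightarrow> (nat \<Rightarrow> 'a::euclidean_space set) \<Rightarrow> ('a \<Rightarrow> real \<Rightarrow> ('a \<times> real) set) \<Rightarrow> bool" where
  "TC_NC_BL T M BL \<longleftrightarrow>
     (\<forall>x. \<exists>r \<Psi>. strat_chart M x r \<Psi> \<and>
        AFS_TC_NC T (\<Psi> ` ball x r) (rectified_strat \<Psi> (ball x r) M)
          (rectified_BL \<Psi> (ball x r) BL))"

subsection \<open>Viscosity subsolutions\<close>

(* The upper semicontinuous envelope of the restriction of f to S.  Unlike Limsup (at z within S),
   the limsup also sees the point z itself when z \<in> S. *)
definition usc_envelope :: "'a::topological_space set \<Rightarrow> ('a \<Rightarrow> ereal) \<Rightarrow> 'a \<Rightarrow> ereal" where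
  "usc_envelope S f z = Limsup (inf (nhds z) (principal S)) f"

(* C^1 functions \<phi> of z = (x, t), given with their space gradient D\<phi> and time derivative \<phi>t:
   GDERIV is the gradient in the product 'a \<times> real. *)
definition C1_with_derivs ::
  "('a::euclidean_space \<times> real) set \<Rightarrow> ('a \<times> real \<Rightarrow> real) \<Rightarrow> ('a \<times> real \<Rightarrow> 'a)
     \<Rightarrow> ('a \<times> real \<Rightarrow> real) \<Rightarrow> bool" where
  "C1_with_derivs S \<phi> D\<phi> \<phi>t \<longleftrightarrow>
     (\<forall>z\<in>S. GDERIV \<phi> z :> (D\<phi> z, \<phi>t z)) \<and> continuous_on S D\<phi> \<and> continuous_on S \<phi>t"

definition local_max_on :: "'a::topological_space set \<Rightarrow> ('a \<Rightarrow> ereal) \<Rightarrow> 'a \<Rightarrow> bool" where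
  "local_max_on S f z \<longleftrightarrow> z \<in> S \<and> (\<forall>\<^sub>F w in at z within S. f w \<le> f z)"

(* u_t + H(x, t, Du) \<le> 0 on S \<times> (0, T); u\<^sup>* is the envelope of u on the whole of
   'a \<times> (0, T], whereas maxima are taken along S only. *)
definition subsolution_on ::
  "real \<Rightarrow> 'a::euclidean_space set \<Rightarrow> ('a \<Rightarrow> real \<Rightarrow> 'a \<Rightarrow> ereal) \<Rightarrow> ('a \<times> real \<Rightarrow> ereal) \<Rightarrow> bool" where
  "subsolution_on T S H u \<longleftrightarrow>
     (\<forall>\<phi> D\<phi> \<phi>t x t.
        C1_with_derivs (UNIV \<times> {0<..<T}) \<phi> D\<phi> \<phi>t \<and>
        local_max_on (S \<times> {0<..<T})
          (\<lambda>z. usc_envelope (UNIV \<times> {0<..T}) u z - ereal (\<phi> z)) (x, t) \<longrightarrow>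
        ereal (\<phi>t (x, t)) + H x t (D\<phi> (x, t)) \<le> 0)"

end

theory Submission
  imports Defs "HOL-Complex_Analysis.Great_Picard"
begin

text \<open>
  Both parts rest on the dynamic programming inequality
  \<open>U(X(0), t) \<le> L(\<tau>) + U(X(\<tau>), t - \<tau>)\<close> along an admissible arc (\<open>dynamic_programming\<close>), applied to
  two families of arcs that can be built explicitly near a point \<open>x\<close> of a stratum \<open>M\<^sup>k\<close> with \<open>k < N\<close>.
  In a chart around \<open>x\<close> the stratum is a piece of the affine subspace \<open>\<Psi>(x) + V\<close>.

  The first family crosses from a nearby point to the stratum.  By normal controllability every small
  vector of \<open>V\<^sup>\<bottom>\<close> is an admissible velocity at all points off the stratum, whichever stratum they lie
  on.  Hence the straight segment orthogonal to \<open>V\<close> is admissible and reaches \<open>M\<^sup>k\<close> after a time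
  proportional to the distance (\<open>normal_arc_to_stratum\<close>), so values of \<open>U\<close> off \<open>M\<^sup>k\<close> are dominated, up to
  a small error, by values on \<open>M\<^sup>k\<close> at nearby points.  Hence the two envelopes agree on \<open>M\<^sup>k\<close>
  (\<open>usc_envelope_stratum\<close>).
  Normal controllability also makes \<open>0\<close> an admissible velocity near \<open>x\<close>; staying at rest bounds \<open>U\<close> from
  above, so the envelope \<open>U\<^sup>*\<close> is finite there.

  The second family stays inside the stratum and starts with almost a prescribed tangential velocity
  and cost \<open>(b, l)\<close>.  Since the tangential sets vary continuously and are compact and convex, the point
  of each of them closest to \<open>(b, l)\<close> depends continuously on the base point
  (\<open>continuous_on_closest_point_hausdorff\<close>); read in the chart it is a continuous vector field with
  values in \<open>V\<close>, and Peano's theorem yields its integral curves (\<open>stratum_arcs\<close>).  If \<open>U\<^sup>* - \<phi>\<close> has a maximum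
  at \<open>(x, t)\<close> along the stratum, the equality of the envelopes provides starting points on the stratum with values of \<open>U\<close>
  close to \<open>U\<^sup>*(x, t)\<close>; dynamic programming along the arc of small duration \<open>h\<close> issued from them
  gives \<open>\<phi>(x, t) - \<phi>(x + h b, t - h) \<le> h l + o(h)\<close>, that is \<open>\<phi>\<^sub>t - D\<phi> \<bullet> b - l \<le> 0\<close>
  (\<open>subsolution_at_base\<close>).  Taking the supremum over \<open>(b, l)\<close> gives the
  subsolution inequality.

  An arc is differentiable only almost everywhere and its cost is the integral of a derivative.  The
  dictionary between derivatives and integrals comes from Lebesgue's differentiation theorem and the
  fundamental theorem of calculus for Lipschitz functions.
\<close>

section \<open>Differentiation and integration of functions of one real variable\<close>

lemma indefinite_integral_right_derivative_ae:
  fixes f :: "real \<Rightarrow> real"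
  assumes "\<And>a b. f integrable_on {a..b}"
  obtains N where "negligible N"
    "\<And>u. u \<notin> N \<Longrightarrow> ((\<lambda>h. integral {u..u + h} f / h) \<longlongrightarrow> f u) (at_right 0)"
proof -
  obtain N where N: "negligible N"
    "\<And>x e. x \<notin> N \<Longrightarrow> 0 < e \<Longrightarrow> \<exists>d>0. \<forall>h. 0 < h \<and> h < d \<longrightarrow>
        norm (integral (cbox x (x + h *\<^sub>R One)) f /\<^sub>R h ^ DIM(real) - f x) < e"
    using integrable_ccontinuous_explicit[of f] assms by (metis cbox_interval)
  show ?thesis
  proof (rule that[OF N(1)])
    fix u assume u: "u \<notin> N"
    show "((\<lambda>h. integral {u..u + h} f / h) \<longlongrightarrow> f u) (at_right 0)"
    proof (rule tendstoI)
      fix e :: real assume "e > 0"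
      from N(2)[OF u this] obtain d where d: "d > 0" "\<And>h. 0 < h \<Longrightarrow> h < d \<Longrightarrow>
        norm (integral (cbox u (u + h *\<^sub>R One)) f /\<^sub>R h ^ DIM(real) - f u) < e" by blast
      show "\<forall>\<^sub>F h in at_right 0. dist (integral {u..u + h} f / h) (f u) < e"
        unfolding eventually_at_right_field
        using d by (intro exI[of _ d]) (auto simp: dist_norm divide_inverse mult.commute)
    qed
  qed
qed

text \<open>Right derivatives of the indefinite integral exist almost everywhere; the left ones are right
  derivatives for the reflected function \<open>x \<mapsto> f (- x)\<close>.\<close>

lemma lebesgue_differentiation:
  fixes f :: "real \<Rightarrow> real"
  assumes f: "f integrable_on {a..b}"
  obtains N where "negligible N"
    "\<And>u. u \<in> {a<..<b} - N \<Longrightarrow> ((\<lambda>u. integral {a..u} f) has_real_derivative f u) (at u)"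
proof -
  define g where "g = (\<lambda>x. if x \<in> {a..b} then f x else 0)"
  have gU: "g integrable_on UNIV"
    unfolding g_def integrable_restrict_UNIV by (rule f)
  have gi: "g integrable_on {c..d}" for c d
    using integrable_on_subcbox[OF gU, of c d] by simp
  have ngi: "(\<lambda>x. g (- x)) integrable_on {c..d}" for c d
    using gi[of "-d" "-c"] Henstock_Kurzweil_Integration.integrable_reflect_real[where a = "-d" and b = "-c" and f = g] by simp
  obtain N1 where N1: "negligible N1"
    "\<And>u. u \<notin> N1 \<Longrightarrow> ((\<lambda>h. integral {u..u + h} g / h) \<longlongrightarrow> g u) (at_right 0)"
    using indefinite_integral_right_derivative_ae[OF gi] by blast
  obtain N2 where N2: "negligible N2"
    "\<And>u. u \<notin> N2 \<Longrightarrow> ((\<lambda>h. integral {u..u + h} (\<lambda>x. g (- x)) / h) \<longlongrightarrow> g (- u)) (at_right 0)"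
    using indefinite_integral_right_derivative_ae[OF ngi] by blast
  have N2': "negligible (uminus ` N2)"
  proof (rule negligible_locally_Lipschitz_image)
    show "\<exists>T B. open T \<and> x \<in> T \<and> (\<forall>y\<in>N2 \<inter> T. norm (- y - - x) \<le> B * norm (y - x))" for x :: real
      by (rule exI[of _ UNIV], rule exI[of _ 1]) auto
  qed (auto simp: N2)
  show ?thesis
  proof (rule that)
    show "negligible (N1 \<union> uminus ` N2)" using N1 N2' by simp
    fix u assume u: "u \<in> {a<..<b} - (N1 \<union> uminus ` N2)"
    have u2: "- u \<notin> N2" using u by force
    have gf: "integral {a..v} g = integral {a..v} f" if "v \<le> b" for v
      by (rule integral_cong) (use that in \<open>auto simp: g_def\<close>)
    have right: "((\<lambda>h. (integral {a..u + h} f - integral {a..u} f) / h) \<longlongrightarrow> f u) (at_right 0)"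
    proof (rule Lim_transform_eventually)
      show "((\<lambda>h. integral {u..u + h} g / h) \<longlongrightarrow> f u) (at_right 0)"
        using N1(2)[of u] u by (auto simp: g_def)
      have "\<forall>\<^sub>F h in at_right 0. h < b - u" "\<forall>\<^sub>F h::real in at_right 0. h > 0"
        using u by (auto simp: eventually_at_right_field intro: exI[of _ "b - u"])
      then show "\<forall>\<^sub>F h in at_right 0. integral {u..u + h} g / h
                  = (integral {a..u + h} f - integral {a..u} f) / h"
      proof eventually_elim
        case (elim h)
        have "integral {a..u} g + integral {u..u + h} g = integral {a..u + h} g"
          by (rule Henstock_Kurzweil_Integration.integral_combine) (use elim u gi in auto)
        then show ?case using gf[of u] gf[of "u + h"] u elim by simp
      qed
    qed
    have left: "((\<lambda>h. (integral {a..u + h} f - integral {a..u} f) / h) \<longlongrightarrow> f u) (at_left 0)"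
      unfolding filterlim_at_left_to_right[of _ _ "0::real"]
    proof (rule Lim_transform_eventually)
      show "((\<lambda>h. integral {- u..- u + h} (\<lambda>x. g (- x)) / h) \<longlongrightarrow> f u) (at_right (- 0))"
        using N2(2)[OF u2] u by (auto simp: g_def)
      have "\<forall>\<^sub>F h in at_right 0. h < u - a" "\<forall>\<^sub>F h::real in at_right 0. h > 0"
        using u by (auto simp: eventually_at_right_field intro: exI[of _ "u - a"])
      then have "\<forall>\<^sub>F h in at_right 0. integral {- u..- u + h} (\<lambda>x. g (- x)) / h
                  = (integral {a..u + - h} f - integral {a..u} f) / - h"
      proof eventually_elim
        case (elim h)
        have "integral {a..u - h} g + integral {u - h..u} g = integral {a..u} g"
          by (rule Henstock_Kurzweil_Integration.integral_combine) (use elim u gi in auto)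
        moreover have "integral {- u..- u + h} (\<lambda>x. g (- x)) = integral {u - h..u} g"
          using Henstock_Kurzweil_Integration.integral_reflect_real[where a = "u - h" and b = u and f = g] by simp
        ultimately show ?case
          using gf[of u] gf[of "u - h"] u elim by (simp add: field_simps)
      qed
      then show "\<forall>\<^sub>F h in at_right (- 0). integral {- u..- u + h} (\<lambda>x. g (- x)) / h
                  = (integral {a..u + - h} f - integral {a..u} f) / - h"
        by simp
    qed
    show "((\<lambda>u. integral {a..u} f) has_real_derivative f u) (at u)"
      unfolding DERIV_def filterlim_at_split using left right by simp
  qed
qed

text \<open>The difference quotients \<open>(L (s + e) - L s) / e\<close> are bounded by the Lipschitz constant and converge to
  \<open>deriv L\<close> almost everywhere, so their integrals converge to the integral of \<open>deriv L\<close>.  With an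
  antiderivative \<open>G\<close> of \<open>L\<close> these integrals are differences of quotients of \<open>G\<close>, whose limits are the
  end values of \<open>L\<close>.\<close>

lemma lipschitz_fundamental_theorem_of_calculus:
  fixes L :: "real \<Rightarrow> real"
  assumes lip: "C-lipschitz_on {a..b} L" and ab: "a \<le> b" and N: "negligible N"
    and D: "\<And>s. s \<in> {a..b} - N \<Longrightarrow> L differentiable (at s)"
  shows "(deriv L has_integral L b - L a) {a..b}"
proof -
  \<comment> \<open>Extending \<open>L\<close> by its end values makes the quotients meaningful near \<open>b\<close>.\<close>
  define E where "E = (\<lambda>s. L (max a (min b s)))"
  have clamp: "max a (min b s) \<in> {a..b}" for s using ab by auto
  have Elip: "\<bar>E s - E s'\<bar> \<le> C * \<bar>s - s'\<bar>" for s s'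
  proof -
    have "\<bar>E s - E s'\<bar> \<le> C * \<bar>max a (min b s) - max a (min b s')\<bar>"
      using lipschitz_onD[OF lip clamp clamp, of s s'] by (simp add: E_def dist_real_def)
    also have "\<dots> \<le> C * \<bar>s - s'\<bar>"
      by (intro mult_left_mono lipschitz_on_nonneg[OF lip]) auto
    finally show ?thesis .
  qed
  have "C-lipschitz_on UNIV E"
    by (rule lipschitz_onI) (use Elip lipschitz_on_nonneg[OF lip] in \<open>auto simp: dist_real_def\<close>)
  then have Econt: "continuous_on S E" for S
    by (meson lipschitz_on_continuous_on continuous_on_subset subset_UNIV)
  obtain G where G: "\<And>x. x \<in> {a - 1..b + 2} \<Longrightarrow>
      (G has_vector_derivative E x) (at x within {a - 1..b + 2})"
    using antiderivative_continuous[OF Econt] by blast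
  have G': "(G has_real_derivative E x) (at x)" if "x \<in> {a..b + 1}" for x
    using G[of x] that at_within_interior[of x "{a - 1..b + 2}"]
    by (simp add: has_real_derivative_iff_has_vector_derivative)
  define e where "e = (\<lambda>n. 1 / real (Suc n))"
  have e: "0 < e n" "e n \<le> 1" for n by (auto simp: e_def)
  have e0: "e \<longlonglongrightarrow> 0" unfolding e_def by (rule LIMSEQ_Suc[OF lim_1_over_n])
  have eat: "filterlim e (at 0) sequentially"
    unfolding filterlim_at using e0 e by (auto intro!: always_eventually simp: less_imp_neq[THEN not_sym])
  define N' where "N' = insert a (insert b N)"
  have N': "negligible N'" using N by (simp add: N'_def)
  define f where "f = (\<lambda>n s. (E (s + e n) - E s) / e n)"
  have fint: "(f n has_integral (G (b + e n) - G b) / e n - (G (a + e n) - G a) / e n) {a..b}" for n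
  proof -
    have "(f n has_integral (\<lambda>s. (G (s + e n) - G s) / e n) b - (\<lambda>s. (G (s + e n) - G s) / e n) a) {a..b}"
    proof (rule fundamental_theorem_of_calculus[OF ab])
      fix s assume s: "s \<in> {a..b}"
      have "((\<lambda>s. G (s + e n)) has_real_derivative E (s + e n)) (at s)"
        using G'[of "s + e n"] e[of n] s by (subst DERIV_shift[symmetric]) auto
      then have "((\<lambda>s. (G (s + e n) - G s) / e n) has_real_derivative f n s) (at s)"
        unfolding f_def using G'[of s] s e(1)[of n]
        by (auto intro!: derivative_eq_intros)
      then show "((\<lambda>s. (G (s + e n) - G s) / e n) has_vector_derivative f n s) (at s within {a..b})"
        by (simp add: has_real_derivative_iff_has_vector_derivative has_vector_derivative_at_within)
    qed
    then show ?thesis by simp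
  qed
  have quot: "(\<lambda>n. (G (c + e n) - G c) / e n) \<longlonglongrightarrow> E c" if "c \<in> {a..b + 1}" for c
    using filterlim_compose[OF G'[OF that, unfolded DERIV_def] eat] .
  have lim: "(\<lambda>n. integral {a..b} (f n)) \<longlonglongrightarrow> L b - L a"
    using tendsto_diff[OF quot[of b] quot[of a]] ab fint[THEN integral_unique]
    by (simp add: E_def)
  \<comment> \<open>Setting everything to \<open>0\<close> on the exceptional set turns convergence almost everywhere into convergence everywhere.\<close>
  define f' where "f' = (\<lambda>n s. if s \<in> N' then 0 else f n s)"
  define d where "d = (\<lambda>s. if s \<in> N' then 0 else deriv L s)"
  have f'int: "(f' n has_integral integral {a..b} (f n)) {a..b}" for n
  proof (rule has_integral_spike[OF N'])
    show "(f n has_integral integral {a..b} (f n)) {a..b}"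
      using fint[of n] by (metis integral_unique)
  qed (simp add: f'_def)
  have bound: "norm (f' n s) \<le> C" for n s
  proof (cases "s \<in> N'")
    case False
    have "\<bar>E (s + e n) - E s\<bar> \<le> C * e n" using Elip[of "s + e n" s] e(1)[of n] by simp
    then show ?thesis using False e(1)[of n]
      by (simp add: f'_def f_def abs_divide pos_divide_le_eq)
  qed (simp add: f'_def lipschitz_on_nonneg[OF lip])
  have conv: "(\<lambda>n. f' n s) \<longlonglongrightarrow> d s" if s: "s \<in> {a..b}" for s
  proof (cases "s \<in> N'")
    case False
    then have sab: "a < s" "s < b" "s \<notin> N" using s by (auto simp: N'_def)
    have "L differentiable (at s)" using D sab by auto
    then have "(L has_real_derivative deriv L s) (at s)"
      using DERIV_deriv_iff_real_differentiable by blast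
    then have "(\<lambda>n. (L (s + e n) - L s) / e n) \<longlonglongrightarrow> deriv L s"
      unfolding DERIV_def using eat filterlim_compose by blast
    moreover have "\<forall>\<^sub>F n in sequentially. (L (s + e n) - L s) / e n = f' n s"
    proof -
      have "\<forall>\<^sub>F n in sequentially. e n < b - s"
        using order_tendstoD(2)[OF e0, of "b - s"] sab by simp
      then show ?thesis
      proof eventually_elim
        case (elim n)
        have "max a (min b (s + e n)) = s + e n" "max a (min b s) = s"
          using sab e(1)[of n] elim by auto
        then show ?case using False by (simp add: f'_def f_def E_def)
      qed
    qed
    ultimately show ?thesis
      using False by (simp add: d_def Lim_transform_eventually)
  qed (simp add: f'_def d_def)
  have f'i: "f' n integrable_on {a..b}" for n using f'int by blast
  have hi: "(\<lambda>_::real. C) integrable_on {a..b}" by auto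
  have di: "d integrable_on {a..b}"
    by (rule dominated_convergence(1)[OF f'i hi bound conv])
  have "(\<lambda>n. integral {a..b} (f' n)) \<longlonglongrightarrow> integral {a..b} d"
    by (rule dominated_convergence(2)[OF f'i hi bound conv])
  then have "(\<lambda>n. integral {a..b} (f n)) \<longlonglongrightarrow> integral {a..b} d"
    unfolding integral_unique[OF f'int] .
  then have "integral {a..b} d = L b - L a" using lim by (rule LIMSEQ_unique)
  then have "(d has_integral L b - L a) {a..b}"
    using di by (metis integrable_integral)
  then show ?thesis
  proof (rule has_integral_spike[OF N', rotated])
    show "deriv L s = d s" if "s \<in> {a..b} - N'" for s using that by (simp add: d_def)
  qed
qed

section \<open>Arcs of the differential inclusion and dynamic programming\<close>

text \<open>Initial pieces of trajectories: the horizon \<open>t\<close> fixes the time argument \<open>t - s\<close> of \<open>BL\<close>, whereas the arc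
  may stop at a duration \<open>\<tau>\<close> smaller than \<open>t\<close>.  This freedom is what concatenation and dynamic programming
  need.\<close>

definition admissible_arc ::
  "('a::euclidean_space \<Rightarrow> real \<Rightarrow> ('a \<times> real) set) \<Rightarrow> real \<Rightarrow> real
     \<Rightarrow> (real \<Rightarrow> 'a) \<Rightarrow> (real \<Rightarrow> real) \<Rightarrow> bool" where
  "admissible_arc BL t \<tau> X L \<longleftrightarrow>
     (\<exists>C. C-lipschitz_on {0..\<tau>} (\<lambda>s. (X s, L s))) \<and> L 0 = 0 \<and>
     (\<exists>N. negligible N \<and> (\<forall>s\<in>{0..\<tau>} - N. \<exists>b l.
        (X has_vector_derivative b) (at s) \<and> (L has_real_derivative l) (at s) \<and>
        (b, l) \<in> BL (X s) (t - s)))"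

lemma trajectories_iff_admissible_arc:
  "(X, L) \<in> trajectories BL x t \<longleftrightarrow> admissible_arc BL t t X L \<and> X 0 = x"
proof -
  define Q where "Q = (\<lambda>s. \<exists>b l. (X has_vector_derivative b) (at s) \<and>
      (L has_real_derivative l) (at s) \<and> (b, l) \<in> BL (X s) (t - s))"
  have "(AE s\<in>{0..t} in lebesgue. Q s) \<longleftrightarrow> (\<exists>N. negligible N \<and> (\<forall>s\<in>{0..t} - N. Q s))"
    (is "?ae \<longleftrightarrow> ?ex")
  proof
    assume ?ae
    then obtain N where "N \<in> null_sets lebesgue"
      "{s \<in> space lebesgue. \<not> (s \<in> {0..t} \<longrightarrow> Q s)} \<subseteq> N"
      unfolding eventually_ae_filter by blast
    then show ?ex by (intro exI[of _ N]) (auto simp: negligible_iff_null_sets)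
  next
    assume ?ex
    then obtain N where "N \<in> null_sets lebesgue" "\<forall>s\<in>{0..t} - N. Q s"
      unfolding negligible_iff_null_sets by blast
    then show ?ae unfolding eventually_ae_filter by (intro bexI[of _ N]) auto
  qed
  then show ?thesis
    unfolding trajectories_def admissible_arc_def Q_def by auto
qed

lemma admissible_arc_cost:
  assumes "admissible_arc BL t \<tau> X L" "0 \<le> \<tau>"
  shows "(deriv L has_integral L \<tau>) {0..\<tau>}"
proof -
  obtain C N where C: "C-lipschitz_on {0..\<tau>} (\<lambda>s. (X s, L s))" and L0: "L 0 = 0"
    and N: "negligible N" "\<And>s. s \<in> {0..\<tau>} - N \<Longrightarrow> \<exists>l. (L has_real_derivative l) (at s)"
    using assms(1) unfolding admissible_arc_def by blast
  have "C-lipschitz_on {0..\<tau>} L"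
  proof (rule lipschitz_onI)
    show "dist (L s) (L u) \<le> C * dist s u" if "s \<in> {0..\<tau>}" "u \<in> {0..\<tau>}" for s u
      using lipschitz_onD[OF C that] dist_snd_le[of "(X s, L s)" "(X u, L u)"] by simp
  qed (rule lipschitz_on_nonneg[OF C])
  from lipschitz_fundamental_theorem_of_calculus[OF this assms(2) N(1)] N(2) L0
  show ?thesis using real_differentiable_def by fastforce
qed

text \<open>By the fundamental theorem of calculus for Lipschitz functions the running cost is \<open>L t\<close>.\<close>

lemma value_fun_eq_Inf_cost:
  assumes "0 \<le> t"
  shows "value_fun BL g (x, t) =
    (INF (X, L) \<in> {(X, L). admissible_arc BL t t X L \<and> X 0 = x}. ereal (L t + g (X t)))"
proof -
  have "trajectories BL x t = {(X, L). admissible_arc BL t t X L \<and> X 0 = x}"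
    using trajectories_iff_admissible_arc by fast
  moreover have "integral {0..t} (\<lambda>s. deriv L s) = L t" if "admissible_arc BL t t X L" for X L
    using admissible_arc_cost[OF that assms] by (rule integral_unique)
  ultimately show ?thesis unfolding value_fun_def by (auto intro!: INF_cong)
qed

text \<open>After time \<open>\<tau>\<close> the first horizon \<open>t\<close> leaves \<open>t - (\<tau> + s) = (t - \<tau>) - s\<close>, so the second arc runs with the
  right time argument.\<close>

lemma admissible_arc_concat:
  assumes arc1: "admissible_arc BL t \<tau> X\<^sub>1 L\<^sub>1" and arc2: "admissible_arc BL (t - \<tau>) \<sigma> X\<^sub>2 L\<^sub>2"
    and eq: "X\<^sub>2 0 = X\<^sub>1 \<tau>" and pos: "0 \<le> \<tau>"
  shows "admissible_arc BL t (\<tau> + \<sigma>) (\<lambda>s. if s \<le> \<tau> then X\<^sub>1 s else X\<^sub>2 (s - \<tau>))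
    (\<lambda>s. if s \<le> \<tau> then L\<^sub>1 s else L\<^sub>1 \<tau> + L\<^sub>2 (s - \<tau>))" (is "admissible_arc BL t _ ?X ?L")
proof -
  obtain C\<^sub>1 N\<^sub>1 where C1: "C\<^sub>1-lipschitz_on {0..\<tau>} (\<lambda>s. (X\<^sub>1 s, L\<^sub>1 s))" and L1: "L\<^sub>1 0 = 0"
    and N1: "negligible N\<^sub>1" "\<And>s. s \<in> {0..\<tau>} - N\<^sub>1 \<Longrightarrow> \<exists>b l.
        (X\<^sub>1 has_vector_derivative b) (at s) \<and> (L\<^sub>1 has_real_derivative l) (at s) \<and>
        (b, l) \<in> BL (X\<^sub>1 s) (t - s)"
    using arc1 unfolding admissible_arc_def by blast
  obtain C\<^sub>2 N\<^sub>2 where C2: "C\<^sub>2-lipschitz_on {0..\<sigma>} (\<lambda>s. (X\<^sub>2 s, L\<^sub>2 s))" and L2: "L\<^sub>2 0 = 0"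
    and N2: "negligible N\<^sub>2" "\<And>s. s \<in> {0..\<sigma>} - N\<^sub>2 \<Longrightarrow> \<exists>b l.
        (X\<^sub>2 has_vector_derivative b) (at s) \<and> (L\<^sub>2 has_real_derivative l) (at s) \<and>
        (b, l) \<in> BL (X\<^sub>2 s) (t - \<tau> - s)"
    using arc2 unfolding admissible_arc_def by blast
  have C2': "C\<^sub>2-lipschitz_on {\<tau>..\<tau> + \<sigma>} (\<lambda>s. (X\<^sub>2 (s - \<tau>), L\<^sub>1 \<tau> + L\<^sub>2 (s - \<tau>)))"
  proof (rule lipschitz_onI)
    fix s u assume "s \<in> {\<tau>..\<tau> + \<sigma>}" "u \<in> {\<tau>..\<tau> + \<sigma>}"
    then have "dist (X\<^sub>2 (s - \<tau>), L\<^sub>2 (s - \<tau>)) (X\<^sub>2 (u - \<tau>), L\<^sub>2 (u - \<tau>)) \<le> C\<^sub>2 * dist (s - \<tau>) (u - \<tau>)"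
      by (intro lipschitz_onD[OF C2]) auto
    then show "dist (X\<^sub>2 (s - \<tau>), L\<^sub>1 \<tau> + L\<^sub>2 (s - \<tau>)) (X\<^sub>2 (u - \<tau>), L\<^sub>1 \<tau> + L\<^sub>2 (u - \<tau>)) \<le> C\<^sub>2 * dist s u"
      by (simp add: dist_Pair_Pair dist_real_def)
  qed (rule lipschitz_on_nonneg[OF C2])
  have "(max C\<^sub>1 C\<^sub>2)-lipschitz_on {0..\<tau> + \<sigma>}
      (\<lambda>s. if s \<le> \<tau> then (X\<^sub>1 s, L\<^sub>1 s) else (X\<^sub>2 (s - \<tau>), L\<^sub>1 \<tau> + L\<^sub>2 (s - \<tau>)))"
    by (rule lipschitz_on_concat_max[OF C1 C2']) (simp add: eq L2)
  also have "(\<lambda>s. if s \<le> \<tau> then (X\<^sub>1 s, L\<^sub>1 s) else (X\<^sub>2 (s - \<tau>), L\<^sub>1 \<tau> + L\<^sub>2 (s - \<tau>)))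
      = (\<lambda>s. (?X s, ?L s))" by auto
  finally have lip: "(max C\<^sub>1 C\<^sub>2)-lipschitz_on {0..\<tau> + \<sigma>} (\<lambda>s. (?X s, ?L s))" .
  have neg: "negligible (insert \<tau> (N\<^sub>1 \<union> (+) \<tau> ` N\<^sub>2))"
    using N1(1) negligible_translation[OF N2(1)] by simp
  have main: "\<exists>b l. (?X has_vector_derivative b) (at s) \<and> (?L has_real_derivative l) (at s) \<and>
        (b, l) \<in> BL (?X s) (t - s)"
    if s: "s \<in> {0..\<tau> + \<sigma>} - insert \<tau> (N\<^sub>1 \<union> (+) \<tau> ` N\<^sub>2)" for s
  proof (cases "s < \<tau>")
    case True
    then obtain b l where bl: "(X\<^sub>1 has_vector_derivative b) (at s)" "(L\<^sub>1 has_real_derivative l) (at s)"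
      "(b, l) \<in> BL (X\<^sub>1 s) (t - s)" using N1(2)[of s] s by auto
    have "(?X has_vector_derivative b) (at s)"
      by (rule has_vector_derivative_transform_within_open[OF bl(1), of "{..<\<tau>}"]) (use True in auto)
    moreover have "(?L has_real_derivative l) (at s)"
      by (rule has_field_derivative_transform_within_open[OF bl(2), of "{..<\<tau>}"]) (use True in auto)
    ultimately show ?thesis using bl(3) True by auto
  next
    case False
    then have sgt: "s > \<tau>" using s by auto
    have "s - \<tau> \<notin> N\<^sub>2" using s by (metis DiffD2 UnCI add.commute diff_add_cancel imageI insertCI)
    then obtain b l where bl: "(X\<^sub>2 has_vector_derivative b) (at (s - \<tau>))"
      "(L\<^sub>2 has_real_derivative l) (at (s - \<tau>))"
      "(b, l) \<in> BL (X\<^sub>2 (s - \<tau>)) (t - \<tau> - (s - \<tau>))" using N2(2)[of "s - \<tau>"] s sgt by auto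
    have "((\<lambda>s. s - \<tau>) has_vector_derivative 1) (at s)"
      unfolding has_real_derivative_iff_has_vector_derivative[symmetric]
      by (auto intro!: derivative_eq_intros)
    then have "((\<lambda>s. X\<^sub>2 (s - \<tau>)) has_vector_derivative b) (at s)"
      using vector_diff_chain_at[of "\<lambda>s. s - \<tau>" 1 s X\<^sub>2 b] bl(1) by (simp add: o_def)
    then have "(?X has_vector_derivative b) (at s)"
      by (rule has_vector_derivative_transform_within_open[of _ _ _ "{\<tau><..}"]) (use sgt in auto)
    moreover have "((\<lambda>s. L\<^sub>1 \<tau> + L\<^sub>2 (s - \<tau>)) has_real_derivative l) (at s)"
      using DERIV_shift[of L\<^sub>2 l s "- \<tau>"] bl(2) by (auto intro!: derivative_eq_intros)
    then have "(?L has_real_derivative l) (at s)"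
      by (rule has_field_derivative_transform_within_open[of _ _ _ "{\<tau><..}"]) (use sgt in auto)
    ultimately show ?thesis using bl(3) sgt by auto
  qed
  show ?thesis
    unfolding admissible_arc_def
  proof (intro conjI)
    show "\<exists>C. C-lipschitz_on {0..\<tau> + \<sigma>} (\<lambda>s. (?X s, ?L s))" using lip by (rule exI)
    show "?L 0 = 0" using L1 pos by simp
  qed (rule exI[of _ "insert \<tau> (N\<^sub>1 \<union> (+) \<tau> ` N\<^sub>2)"], intro conjI neg ballI main)
qed

lemma value_fun_le_cost:
  assumes "admissible_arc BL t t X L" and "0 \<le> t"
  shows "value_fun BL g (X 0, t) \<le> ereal (L t + g (X t))"
proof -
  have "(X, L) \<in> {(Y, L). admissible_arc BL t t Y L \<and> Y 0 = X 0}" using assms by simp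
  then show ?thesis
    using assms(2) INF_lower[of "(X, L)" _ "\<lambda>(X, L). ereal (L t + g (X t))"]
    by (subst value_fun_eq_Inf_cost) simp_all
qed

lemma dynamic_programming:
  assumes arc: "admissible_arc BL t \<tau> X L" and \<tau>: "0 \<le> \<tau>" "\<tau> \<le> t"
  shows "value_fun BL g (X 0, t) \<le> ereal (L \<tau>) + value_fun BL g (X \<tau>, t - \<tau>)"
proof -
  have "value_fun BL g (X 0, t) - ereal (L \<tau>) \<le> ereal (K (t - \<tau>) + g (Y (t - \<tau>)))"
    if Y: "admissible_arc BL (t - \<tau>) (t - \<tau>) Y K" "Y 0 = X \<tau>" for Y K
  proof -
    have K0: "K 0 = 0" using Y(1) by (simp add: admissible_arc_def)
    define Z where "Z = (\<lambda>s. if s \<le> \<tau> then X s else Y (s - \<tau>))"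
    define J where "J = (\<lambda>s. if s \<le> \<tau> then L s else L \<tau> + K (s - \<tau>))"
    have "admissible_arc BL t t Z J"
      using admissible_arc_concat[OF arc Y(1,2) \<tau>(1)] by (simp add: Z_def J_def)
    moreover have "Z 0 = X 0" using \<tau> by (simp add: Z_def)
    ultimately have "value_fun BL g (X 0, t) \<le> ereal (J t + g (Z t))"
      using \<tau> value_fun_le_cost[of BL t Z J g] by simp
    also have "J t = L \<tau> + K (t - \<tau>)" using \<tau> K0 by (cases "t = \<tau>") (auto simp: J_def)
    also have "Z t = Y (t - \<tau>)" using \<tau> Y(2) by (cases "t = \<tau>") (auto simp: Z_def)
    finally have "value_fun BL g (X 0, t) \<le> ereal (K (t - \<tau>) + g (Y (t - \<tau>))) + ereal (L \<tau>)"
      by (simp add: ac_simps)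
    then show ?thesis by (simp add: ereal_minus_le)
  qed
  then have "value_fun BL g (X 0, t) - ereal (L \<tau>) \<le>
      (INF (Y, K) \<in> {(Y, K). admissible_arc BL (t - \<tau>) (t - \<tau>) Y K \<and> Y 0 = X \<tau>}.
        ereal (K (t - \<tau>) + g (Y (t - \<tau>))))"
    by (intro INF_greatest) auto
  also have "\<dots> = value_fun BL g (X \<tau>, t - \<tau>)"
    using \<tau> by (subst value_fun_eq_Inf_cost) simp_all
  finally show ?thesis by (simp add: ereal_minus_le add.commute)
qed

lemma admissible_arc_cost_bound:
  assumes arc: "admissible_arc BL t \<tau> X L" and \<tau>: "0 \<le> \<tau>" "\<tau> \<le> t" "t \<le> T"
    and K: "\<And>x t b l. t \<in> {0..T} \<Longrightarrow> (b, l) \<in> BL x t \<Longrightarrow> \<bar>l\<bar> \<le> K" and "K \<ge> 0"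
  shows "\<bar>L \<tau>\<bar> \<le> K * \<tau>"
proof -
  obtain N where N: "negligible N" "\<And>s. s \<in> {0..\<tau>} - N \<Longrightarrow> \<exists>b l.
        (X has_vector_derivative b) (at s) \<and> (L has_real_derivative l) (at s) \<and>
        (b, l) \<in> BL (X s) (t - s)"
    using arc unfolding admissible_arc_def by auto
  define d where "d = (\<lambda>s. if s \<in> N then 0 else deriv L s)"
  have "(d has_integral L \<tau>) {0..\<tau>}"
    by (rule has_integral_spike[OF N(1) _ admissible_arc_cost[OF arc \<tau>(1)]]) (simp add: d_def)
  moreover have "norm (d s) \<le> K" if s: "s \<in> {0..\<tau>}" for s
  proof (cases "s \<in> N")
    case False
    then obtain b l where "(L has_real_derivative l) (at s)" "(b, l) \<in> BL (X s) (t - s)"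
      using N(2)[of s] s by auto
    then show ?thesis using K[of "t - s" b l "X s"] s \<tau> False by (auto simp: d_def DERIV_imp_deriv)
  qed (simp add: d_def \<open>K \<ge> 0\<close>)
  ultimately show ?thesis
    using has_integral_bound_real[of K "{}" d "L \<tau>" 0 \<tau>] \<open>K \<ge> 0\<close> \<tau> by auto
qed

text \<open>The infimum is never \<open>- \<infinity>\<close>, because costs are bounded by \<open>K\<close> per unit of time; this keeps the
  envelopes finite from below.\<close>

lemma value_fun_lower_bound:
  assumes t: "t \<in> {0..T}"
    and K: "\<And>x t b l. t \<in> {0..T} \<Longrightarrow> (b, l) \<in> BL x t \<Longrightarrow> \<bar>l\<bar> \<le> K" and "K \<ge> 0"
    and G: "\<And>y. \<bar>g y\<bar> \<le> G"
  shows "ereal (- (K * T) - G) \<le> value_fun BL g (x, t)"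
proof -
  have "ereal (- (K * T) - G) \<le> ereal (L t + g (X t))" if "admissible_arc BL t t X L" for X L
  proof -
    have "\<bar>L t\<bar> \<le> K * t" by (rule admissible_arc_cost_bound[OF that _ _ _ K]) (use t \<open>K \<ge> 0\<close> in auto)
    also have "\<dots> \<le> K * T" using t \<open>K \<ge> 0\<close> by (intro mult_left_mono) auto
    finally show ?thesis using G[of "X t"] by simp
  qed
  then have "ereal (- (K * T) - G) \<le>
      (INF (X, L) \<in> {(X, L). admissible_arc BL t t X L \<and> X 0 = x}. ereal (L t + g (X t)))"
    by (intro INF_greatest) auto
  then show ?thesis using t value_fun_eq_Inf_cost[of t BL g x] by simp
qed

text \<open>A differentiable curve together with an integrable, possibly very irregular, choice of running
  costs is an admissible arc, since the indefinite integral of the costs has them as derivatives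
  almost everywhere.\<close>

lemma admissible_arc_of_velocity:
  fixes X :: "real \<Rightarrow> 'a::euclidean_space"
  assumes X: "\<And>s. s \<in> {0..\<tau>} \<Longrightarrow> (X has_vector_derivative b s) (at s within {0..\<tau>})"
    and l: "l integrable_on {0..\<tau>}"
    and mem: "\<And>s. s \<in> {0..\<tau>} \<Longrightarrow> (b s, l s) \<in> BL (X s) (t - s)"
    and K: "\<And>s. s \<in> {0..\<tau>} \<Longrightarrow> norm (b s) \<le> K" "\<And>s. s \<in> {0..\<tau>} \<Longrightarrow> \<bar>l s\<bar> \<le> K" "K \<ge> 0"
  shows "admissible_arc BL t \<tau> X (\<lambda>s. integral {0..s} l)"
proof -
  have lipX: "K-lipschitz_on {0..\<tau>} X"
  proof (rule bounded_derivative_imp_lipschitz)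
    show "(X has_derivative (\<lambda>h. h *\<^sub>R b s)) (at s within {0..\<tau>})" if "s \<in> {0..\<tau>}" for s
      using X[OF that] by (simp add: has_vector_derivative_def)
    show "onorm (\<lambda>h. h *\<^sub>R b s) \<le> K" if "s \<in> {0..\<tau>}" for s
      using K(1)[OF that] by (intro onorm_le) (simp add: mult.commute[of K] mult_left_mono)
  qed (use K in auto)
  have lipL: "K-lipschitz_on {0..\<tau>} (\<lambda>s. integral {0..s} l)"
  proof (rule lipschitz_onI[OF _ K(3)])
    have le: "\<bar>integral {0..v} l - integral {0..u} l\<bar> \<le> K * (v - u)" if "0 \<le> u" "u \<le> v" "v \<le> \<tau>" for u v
    proof -
      have li: "l integrable_on {0..v}" "l integrable_on {u..v}"
        using l that by (auto elim: integrable_on_subinterval)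
      have "integral {0..u} l + integral {u..v} l = integral {0..v} l"
        by (rule Henstock_Kurzweil_Integration.integral_combine) (use that li in auto)
      moreover have "norm (integral {u..v} l) \<le> K * (v - u)"
        using has_integral_bound_real[OF K(3) finite.emptyI integrable_integral[OF li(2)]] K(2) that by auto
      ultimately show ?thesis using that by simp
    qed
    show "dist (integral {0..u} l) (integral {0..v} l) \<le> K * dist u v"
      if "u \<in> {0..\<tau>}" "v \<in> {0..\<tau>}" for u v
      using le[of u v] le[of v u] that by (cases "u \<le> v") (auto simp: dist_real_def abs_minus_commute)
  qed
  obtain N where N: "negligible N" "\<And>u. u \<in> {0<..<\<tau>} - N \<Longrightarrow>
      ((\<lambda>u. integral {0..u} l) has_real_derivative l u) (at u)"
    using lebesgue_differentiation[OF l] by blast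
  have "\<exists>b' l'. (X has_vector_derivative b') (at s) \<and>
        ((\<lambda>s. integral {0..s} l) has_real_derivative l') (at s) \<and> (b', l') \<in> BL (X s) (t - s)"
    if s: "s \<in> {0..\<tau>} - insert 0 (insert \<tau> N)" for s
  proof -
    have "at s within {0..\<tau>} = at s" by (rule at_within_interior) (use s in auto)
    then have "(X has_vector_derivative b s) (at s)" using X[of s] s by simp
    then show ?thesis using N(2)[of s] mem[of s] s by (intro exI[of _ "b s"] exI[of _ "l s"]) auto
  qed
  then show ?thesis
    unfolding admissible_arc_def using lipschitz_on_Pair[OF lipX lipL] N(1)
    by (intro conjI exI[of _ "insert 0 (insert \<tau> N)"]) auto
qed

lemma H_BL_bound:
  assumes "H_BL T BL"
  obtains K where "K > 0" "\<And>x t b l. t \<in> {0..T} \<Longrightarrow> (b, l) \<in> BL x t \<Longrightarrow> norm b \<le> K"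
    "\<And>x t b l. t \<in> {0..T} \<Longrightarrow> (b, l) \<in> BL x t \<Longrightarrow> \<bar>l\<bar> \<le> K"
proof -
  from assms obtain K where K: "K > 0" "\<forall>x. \<forall>t\<in>{0..T}. \<forall>(b, l)\<in>BL x t. norm b \<le> K \<and> \<bar>l\<bar> \<le> K"
    unfolding H_BL_def by (elim conjE exE)
  have "norm b \<le> K \<and> \<bar>l\<bar> \<le> K" if "t \<in> {0..T}" "(b, l) \<in> BL x t" for x t b l
    using bspec[OF bspec[OF spec[OF K(2)] that(1)] that(2)] by simp
  then show ?thesis using that K(1) by blast
qed

text \<open>A limit point outside the limiting value could be separated from that closed set by open sets, and upper
  semicontinuity keeps the nearby values on the far side.\<close>

lemma H_BL_closed_graph:
  assumes H: "H_BL T BL" and seq: "x \<longlonglongrightarrow> x\<^sub>0" "t \<longlonglongrightarrow> t\<^sub>0" "q \<longlonglongrightarrow> q\<^sub>0"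
    and t: "\<And>n. t n \<in> {0..T}" and q: "\<And>n. q n \<in> BL (x n) (t n)"
  shows "q\<^sub>0 \<in> BL x\<^sub>0 t\<^sub>0"
proof (rule ccontr)
  assume q0: "q\<^sub>0 \<notin> BL x\<^sub>0 t\<^sub>0"
  have t0: "t\<^sub>0 \<in> {0..T}"
    using closed_sequentially[of "{0..T}" t t\<^sub>0] t seq(2) by auto
  then have "closed (BL x\<^sub>0 t\<^sub>0)" using H compact_imp_closed unfolding H_BL_def by blast
  then obtain A W where AW: "open A" "open W" "q\<^sub>0 \<in> A" "BL x\<^sub>0 t\<^sub>0 \<subseteq> W" "A \<inter> W = {}"
    using separation_normal[of "{q\<^sub>0}" "BL x\<^sub>0 t\<^sub>0"] q0 by auto
  then obtain \<omega> where \<omega>: "open \<omega>" "(x\<^sub>0, t\<^sub>0) \<in> \<omega>"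
    "\<And>x t. (x, t) \<in> \<omega> \<Longrightarrow> t \<in> {0..T} \<Longrightarrow> BL x t \<subseteq> W"
  proof -
    from H have "\<forall>x\<^sub>0. \<forall>t\<^sub>0\<in>{0..T}. \<forall>W. open W \<and> BL x\<^sub>0 t\<^sub>0 \<subseteq> W \<longrightarrow>
        (\<exists>\<omega>. open \<omega> \<and> (x\<^sub>0, t\<^sub>0) \<in> \<omega> \<and> (\<forall>(x, t)\<in>\<omega>. t \<in> {0..T} \<longrightarrow> BL x t \<subseteq> W))"
      unfolding H_BL_def by (elim conjE)
    then have "\<exists>\<omega>. open \<omega> \<and> (x\<^sub>0, t\<^sub>0) \<in> \<omega> \<and> (\<forall>(x, t)\<in>\<omega>. t \<in> {0..T} \<longrightarrow> BL x t \<subseteq> W)"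
      using t0 AW(2,4) by (elim allE ballE impE) auto
    then obtain \<omega> where "open \<omega>" "(x\<^sub>0, t\<^sub>0) \<in> \<omega>" and
      *: "\<forall>(x, t)\<in>\<omega>. t \<in> {0..T} \<longrightarrow> BL x t \<subseteq> W" by blast
    show ?thesis
    proof (rule that[of \<omega>])
      show "BL x t \<subseteq> W" if "(x, t) \<in> \<omega>" "t \<in> {0..T}" for x t
        using bspec[OF * that(1)] that(2) by simp
    qed fact+
  qed
  have "\<forall>\<^sub>F n in sequentially. (x n, t n) \<in> \<omega>"
    using topological_tendstoD[OF tendsto_Pair[OF seq(1,2)]] \<omega> by simp
  moreover have "\<forall>\<^sub>F n in sequentially. q n \<in> A"
    using topological_tendstoD[OF seq(3)] AW by simp
  ultimately have "\<forall>\<^sub>F n in sequentially. False"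
  proof eventually_elim
    case (elim n)
    then show False using \<omega>(3)[of "x n" "t n"] t[of n] q[of n] AW by auto
  qed
  then show False by simp
qed

text \<open>The projection of a closed graph is closed because the costs, which are projected away, stay in a
  compact interval.\<close>

lemma B_of_closed_graph:
  assumes H: "H_BL T BL" and seq: "x \<longlonglongrightarrow> x\<^sub>0" "t \<longlonglongrightarrow> t\<^sub>0" "b \<longlonglongrightarrow> b\<^sub>0"
    and t: "\<And>n. t n \<in> {0..T}" and b: "\<And>n. b n \<in> B_of BL (x n) (t n)"
  shows "b\<^sub>0 \<in> B_of BL x\<^sub>0 t\<^sub>0"
proof -
  obtain K where K: "\<And>x t b l. t \<in> {0..T} \<Longrightarrow> (b, l) \<in> BL x t \<Longrightarrow> \<bar>l\<bar> \<le> K"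
    using H_BL_bound[OF H] by metis
  obtain l where l: "\<And>n. (b n, l n) \<in> BL (x n) (t n)" using b unfolding B_of_def by simp metis
  have "seq_compact {-K..K}" using compact_eq_seq_compact_metric compact_Icc by blast
  moreover have "l n \<in> {-K..K}" for n using K[OF t l, of n] by auto
  ultimately obtain l\<^sub>0 r where r: "strict_mono (r :: nat \<Rightarrow> nat)" "(l \<circ> r) \<longlonglongrightarrow> l\<^sub>0"
    unfolding seq_compact_def by meson
  have "(b\<^sub>0, l\<^sub>0) \<in> BL x\<^sub>0 t\<^sub>0"
  proof (rule H_BL_closed_graph[OF H])
    show "(x \<circ> r) \<longlonglongrightarrow> x\<^sub>0" "(t \<circ> r) \<longlonglongrightarrow> t\<^sub>0"
      using seq r(1) by (auto intro: LIMSEQ_subseq_LIMSEQ)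
    show "(\<lambda>n. ((b \<circ> r) n, (l \<circ> r) n)) \<longlonglongrightarrow> (b\<^sub>0, l\<^sub>0)"
      by (rule tendsto_Pair[OF LIMSEQ_subseq_LIMSEQ[OF seq(3) r(1)] r(2)])
  qed (use t l in auto)
  then show ?thesis by (auto simp: B_of_def)
qed

text \<open>The least admissible cost is a lower semicontinuous function of time: its sublevel sets are
  projections of compact pieces of the graph \<open>\<Gamma>\<close>, hence closed.  It is therefore measurable, and it is bounded.\<close>

lemma measurable_cost_selection:
  fixes X b :: "real \<Rightarrow> 'a::euclidean_space"
  assumes H: "H_BL T BL" and X: "continuous_on {0..\<tau>} X" and b: "continuous_on {0..\<tau>} b"
    and t: "\<tau> \<le> t" "t \<le> T"
    and mem: "\<And>s. s \<in> {0..\<tau>} \<Longrightarrow> b s \<in> B_of BL (X s) (t - s)"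
  obtains l where "l integrable_on {0..\<tau>}" "\<And>s. s \<in> {0..\<tau>} \<Longrightarrow> (b s, l s) \<in> BL (X s) (t - s)"
proof -
  obtain K where K: "K > 0" "\<And>x t b l. t \<in> {0..T} \<Longrightarrow> (b, l) \<in> BL x t \<Longrightarrow> \<bar>l\<bar> \<le> K"
    using H_BL_bound[OF H] by metis
  define \<Gamma> where "\<Gamma> = {(s, l). s \<in> {0..\<tau>} \<and> (b s, l) \<in> BL (X s) (t - s)}"
  have lK: "\<bar>l\<bar> \<le> K" if "(s, l) \<in> \<Gamma>" for s l using K(2)[of "t - s" "b s" l "X s"] that t by (auto simp: \<Gamma>_def)
  have "closed \<Gamma>"
    unfolding closed_sequential_limits
  proof clarify
    fix u s l assume u: "\<forall>n. u n \<in> \<Gamma>" and lim: "u \<longlonglongrightarrow> (s, l)"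
    define \<sigma> \<eta> where "\<sigma> = (\<lambda>n. fst (u n))" and "\<eta> = (\<lambda>n. snd (u n))"
    have mem: "\<sigma> n \<in> {0..\<tau>}" "(b (\<sigma> n), \<eta> n) \<in> BL (X (\<sigma> n)) (t - \<sigma> n)" for n
      using u[rule_format, of n] by (auto simp: \<Gamma>_def \<sigma>_def \<eta>_def split: prod.splits)
    have \<sigma>: "\<sigma> \<longlonglongrightarrow> s" and \<eta>: "\<eta> \<longlonglongrightarrow> l"
      using tendsto_fst[OF lim] tendsto_snd[OF lim] by (simp_all add: \<sigma>_def \<eta>_def)
    have s: "s \<in> {0..\<tau>}" using closed_sequentially[of "{0..\<tau>}" \<sigma> s] mem(1) \<sigma> by auto
    have "(\<lambda>n. X (\<sigma> n)) \<longlonglongrightarrow> X s" "(\<lambda>n. b (\<sigma> n)) \<longlonglongrightarrow> b s"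
      using X b s mem(1) \<sigma> unfolding continuous_on_sequentially by (auto simp: o_def)
    then have "(\<lambda>n. (b (\<sigma> n), \<eta> n)) \<longlonglongrightarrow> (b s, l)" "(\<lambda>n. t - \<sigma> n) \<longlonglongrightarrow> t - s"
      "(\<lambda>n. X (\<sigma> n)) \<longlonglongrightarrow> X s"
      by (simp_all add: tendsto_Pair \<eta> tendsto_diff[OF tendsto_const \<sigma>])
    moreover have "t - \<sigma> n \<in> {0..T}" for n using mem(1)[of n] t by auto
    ultimately have "(b s, l) \<in> BL (X s) (t - s)"
      using H_BL_closed_graph[OF H] mem(2) by blast
    then show "(s, l) \<in> \<Gamma>" using s by (simp add: \<Gamma>_def)
  qed
  moreover have "\<Gamma> \<subseteq> {0..\<tau>} \<times> {-K..K}" using lK by (force simp: \<Gamma>_def)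
  moreover have "compact ({0..\<tau>} \<times> {-K..K})" by (intro compact_Times compact_Icc)
  ultimately have comp: "compact \<Gamma>"
    using closed_Int_compact[of \<Gamma> "{0..\<tau>} \<times> {-K..K}"] by (simp add: Int_absorb2)
  define l where "l = (\<lambda>s. Inf {r. (s, r) \<in> \<Gamma>})"
  have l: "(s, l s) \<in> \<Gamma>" and lmin: "\<And>r. (s, r) \<in> \<Gamma> \<Longrightarrow> l s \<le> r" if s: "s \<in> {0..\<tau>}" for s
  proof -
    have bb: "bdd_below {r. (s, r) \<in> \<Gamma>}" using lK by (intro bdd_belowI[of _ "-K"]) fastforce
    have "{r. (s, r) \<in> \<Gamma>} = snd ` (\<Gamma> \<inter> {s} \<times> UNIV)" by force
    moreover have "compact (snd ` (\<Gamma> \<inter> {s} \<times> UNIV))"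
      using comp by (intro compact_continuous_image compact_Int_closed closed_Times continuous_intros) auto
    ultimately have cl: "closed {r. (s, r) \<in> \<Gamma>}" using compact_imp_closed by metis
    moreover have "{r. (s, r) \<in> \<Gamma>} \<noteq> {}" using mem[OF s] s by (auto simp: \<Gamma>_def B_of_def)
    ultimately show "(s, l s) \<in> \<Gamma>"
      using closed_contains_Inf[OF _ bb] unfolding l_def by blast
    show "l s \<le> r" if "(s, r) \<in> \<Gamma>" for r
      unfolding l_def by (rule cInf_lower[OF _ bb]) (use that in auto)
  qed
  have "l \<in> borel_measurable (lebesgue_on {0..\<tau>})"
    unfolding borel_measurable_iff_le
  proof
    fix c
    have eq: "{s \<in> space (lebesgue_on {0..\<tau>}). l s \<le> c} = fst ` (\<Gamma> \<inter> UNIV \<times> {..c})"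
    proof (intro set_eqI iffI)
      fix s assume "s \<in> {s \<in> space (lebesgue_on {0..\<tau>}). l s \<le> c}"
      then have "(s, l s) \<in> \<Gamma> \<inter> UNIV \<times> {..c}" using l[of s] by simp
      then show "s \<in> fst ` (\<Gamma> \<inter> UNIV \<times> {..c})" by (rule image_eqI[rotated]) simp
    next
      fix s assume "s \<in> fst ` (\<Gamma> \<inter> UNIV \<times> {..c})"
      then obtain r where r: "(s, r) \<in> \<Gamma>" "r \<le> c" by auto
      then have "s \<in> {0..\<tau>}" by (simp add: \<Gamma>_def)
      then show "s \<in> {s \<in> space (lebesgue_on {0..\<tau>}). l s \<le> c}" using lmin[of s r] r by simp
    qed
    have "compact (fst ` (\<Gamma> \<inter> UNIV \<times> {..c}))"
      using comp by (intro compact_continuous_image compact_Int_closed closed_Times continuous_intros) auto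
    moreover have "fst ` (\<Gamma> \<inter> UNIV \<times> {..c}) \<subseteq> {0..\<tau>}" by (auto simp: \<Gamma>_def)
    ultimately show "{s \<in> space (lebesgue_on {0..\<tau>}). l s \<le> c} \<in> sets (lebesgue_on {0..\<tau>})"
      unfolding eq by (simp add: sets_restrict_space_iff borel_compact)
  qed
  then have "l integrable_on {0..\<tau>}"
    by (rule measurable_bounded_by_integrable_imp_integrable_real[where g = "\<lambda>_. K"])
       (use lK l in auto)
  then show ?thesis using that l by (auto simp: \<Gamma>_def)
qed

section \<open>Existence of solutions of ordinary differential equations\<close>

text \<open>Method of steps: with a delay \<open>e\<close>, the right-hand side on \<open>[0, (m + 1) e]\<close> only involves the solution on
  \<open>[0, m e]\<close>, so the Picard iterates stop changing after finitely many rounds.\<close>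

lemma delayed_ode_solution:
  fixes F :: "real \<Rightarrow> 'a::euclidean_space \<Rightarrow> 'a"
  assumes F: "continuous_on UNIV (\<lambda>(s, y). F s y)" and a: "a \<ge> 0" and e: "e > 0"
  obtains Z where "continuous_on {0..a} Z"
    "\<And>s. s \<in> {0..a} \<Longrightarrow> Z s = y\<^sub>0 + integral {0..max 0 (s - e)} (\<lambda>\<sigma>. F \<sigma> (Z \<sigma>))"
proof -
  define P where "P = rec_nat (\<lambda>s. y\<^sub>0) (\<lambda>m Q s. y\<^sub>0 + integral {0..max 0 (s - e)} (\<lambda>\<sigma>. F \<sigma> (Q \<sigma>)))"
  have P0: "P 0 s = y\<^sub>0"
    and PS: "P (Suc m) s = y\<^sub>0 + integral {0..max 0 (s - e)} (\<lambda>\<sigma>. F \<sigma> (P m \<sigma>))" for m s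
    by (simp_all add: P_def)
  have cont: "continuous_on {0..a} (P m)" for m
  proof (induction m)
    case (Suc m)
    have "continuous_on {0..a} (\<lambda>\<sigma>. F \<sigma> (P m \<sigma>))"
      using continuous_on_compose2[OF F, of "{0..a}" "\<lambda>\<sigma>. (\<sigma>, P m \<sigma>)"]
        continuous_on_Pair[OF continuous_on_id Suc] by simp
    then have "(\<lambda>\<sigma>. F \<sigma> (P m \<sigma>)) integrable_on {0..a}" by (rule integrable_continuous_real)
    then have "continuous_on {0..a} (\<lambda>u. integral {0..u} (\<lambda>\<sigma>. F \<sigma> (P m \<sigma>)))"
      by (rule indefinite_integral_continuous_1)
    then have "continuous_on {0..a} (\<lambda>s. integral {0..max 0 (s - e)} (\<lambda>\<sigma>. F \<sigma> (P m \<sigma>)))"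
      by (rule continuous_on_compose2) (use a e in \<open>auto intro!: continuous_intros\<close>)
    then show ?case unfolding PS by (intro continuous_intros)
  qed (simp add: P0)
  have stable: "s \<le> real (Suc m) * e \<Longrightarrow> P (Suc m) s = P m s" for m s
  proof (induction m arbitrary: s)
    case 0
    then show ?case by (simp add: PS P0)
  next
    case (Suc m)
    have "integral {0..max 0 (s - e)} (\<lambda>\<sigma>. F \<sigma> (P (Suc m) \<sigma>))
        = integral {0..max 0 (s - e)} (\<lambda>\<sigma>. F \<sigma> (P m \<sigma>))"
    proof (rule integral_cong)
      fix \<sigma> assume "\<sigma> \<in> {0..max 0 (s - e)}"
      moreover have "0 \<le> real (Suc m) * e" using e by simp
      ultimately have "\<sigma> \<le> real (Suc m) * e" using Suc.prems by (auto simp: algebra_simps max_def split: if_splits)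
      then show "F \<sigma> (P (Suc m) \<sigma>) = F \<sigma> (P m \<sigma>)" using Suc.IH by simp
    qed
    then show ?case by (simp only: PS)
  qed
  obtain m where "a < real m * e" using reals_Archimedean3[OF e] by blast
  then have "s \<le> real (Suc m) * e" if "s \<in> {0..a}" for s using that e by (auto simp: algebra_simps)
  then have "P m s = y\<^sub>0 + integral {0..max 0 (s - e)} (\<lambda>\<sigma>. F \<sigma> (P m \<sigma>))" if "s \<in> {0..a}" for s
    using stable[of s m] PS[of m s] that by metis
  then show ?thesis using that cont by blast
qed

text \<open>Tonelli's proof: solutions of the equations with delays tending to \<open>0\<close> are equi-Lipschitz, and any
  uniform limit of them solves the equation without delay.\<close>

lemma peano_existence:
  fixes F :: "real \<Rightarrow> 'a::euclidean_space \<Rightarrow> 'a"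
  assumes F: "continuous_on UNIV (\<lambda>(s, y). F s y)" and a: "a \<ge> 0"
    and K: "\<And>s y. norm (F s y) \<le> K"
  obtains Y where "Y 0 = y\<^sub>0"
    "\<And>s. s \<in> {0..a} \<Longrightarrow> (Y has_vector_derivative F s (Y s)) (at s within {0..a})"
proof -
  have K0: "K \<ge> 0" using K[of 0 0] norm_ge_zero order_trans by blast
  define e where "e = (\<lambda>n. 1 / real (Suc n))"
  have e: "0 < e n" for n by (auto simp: e_def)
  have e0: "e \<longlonglongrightarrow> 0" unfolding e_def by (rule LIMSEQ_Suc[OF lim_1_over_n])
  have "\<exists>Z. continuous_on {0..a} Z \<and>
    (\<forall>s\<in>{0..a}. Z s = y\<^sub>0 + integral {0..max 0 (s - e n)} (\<lambda>\<sigma>. F \<sigma> (Z \<sigma>)))" for n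
    using delayed_ode_solution[OF F a e] by metis
  then obtain Z where Zc: "\<And>n. continuous_on {0..a} (Z n)" and
    Z: "\<And>n s. s \<in> {0..a} \<Longrightarrow> Z n s = y\<^sub>0 + integral {0..max 0 (s - e n)} (\<lambda>\<sigma>. F \<sigma> (Z n \<sigma>))"
    by metis
  have Fc: "continuous_on {0..a} (\<lambda>\<sigma>. F \<sigma> (W \<sigma>))" if "continuous_on {0..a} W" for W
    using continuous_on_compose2[OF F, of "{0..a}" "\<lambda>\<sigma>. (\<sigma>, W \<sigma>)"]
      continuous_on_Pair[OF continuous_on_id that] by simp
  have Fi: "(\<lambda>\<sigma>. F \<sigma> (W \<sigma>)) integrable_on {u..v}" if "continuous_on {0..a} W" "0 \<le> u" "v \<le> a" for W u v
    by (rule integrable_continuous_real, rule continuous_on_subset[OF Fc[OF that(1)]]) (use that in auto)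
  have step: "norm (integral {0..u} (\<lambda>\<sigma>. F \<sigma> (W \<sigma>)) - integral {0..v} (\<lambda>\<sigma>. F \<sigma> (W \<sigma>))) \<le> K * \<bar>u - v\<bar>"
    if W: "continuous_on {0..a} W" and uv: "u \<in> {0..a}" "v \<in> {0..a}" for W u v
  proof -
    have *: "norm (integral {0..v} (\<lambda>\<sigma>. F \<sigma> (W \<sigma>)) - integral {0..u} (\<lambda>\<sigma>. F \<sigma> (W \<sigma>))) \<le> K * (v - u)"
      if "u \<le> v" "u \<in> {0..a}" "v \<in> {0..a}" for u v
    proof -
      have "integral {0..u} (\<lambda>\<sigma>. F \<sigma> (W \<sigma>)) + integral {u..v} (\<lambda>\<sigma>. F \<sigma> (W \<sigma>))
          = integral {0..v} (\<lambda>\<sigma>. F \<sigma> (W \<sigma>))"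
        by (rule Henstock_Kurzweil_Integration.integral_combine) (use that Fi[OF W] in auto)
      moreover have "norm (integral {u..v} (\<lambda>\<sigma>. F \<sigma> (W \<sigma>))) \<le> K * (v - u)"
        by (rule integral_bound) (use that K continuous_on_subset[OF Fc[OF W], of "{u..v}"] in auto)
      ultimately show ?thesis by (metis add_diff_cancel_left')
    qed
    show ?thesis using *[of u v] *[of v u] uv
      by (cases "u \<le> v") (auto simp: norm_minus_commute)
  qed
  have Zlip: "norm (Z n s - Z n s') \<le> K * \<bar>s - s'\<bar>" if "s \<in> {0..a}" "s' \<in> {0..a}" for n s s'
  proof -
    have "norm (Z n s - Z n s') \<le> K * \<bar>max 0 (s - e n) - max 0 (s' - e n)\<bar>"
      unfolding Z[OF that(1)] Z[OF that(2)] add_diff_cancel_left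
      by (rule step[OF Zc]) (use that e[of n] in auto)
    also have "\<dots> \<le> K * \<bar>s - s'\<bar>" by (intro mult_left_mono K0) auto
    finally show ?thesis .
  qed
  have Z0: "Z n 0 = y\<^sub>0" for n using Z[of 0 n] a e[of n] by simp
  obtain Y k where Yc: "continuous_on {0..a} Y" and k: "strict_mono (k :: nat \<Rightarrow> nat)"
    and YZ: "\<And>\<epsilon>. 0 < \<epsilon> \<Longrightarrow> \<exists>N. \<forall>n x. n \<ge> N \<and> x \<in> {0..a} \<longrightarrow> norm (Z (k n) x - Y x) < \<epsilon>"
  proof (rule Arzela_Ascoli[of "{0..a}" Z "norm y\<^sub>0 + K * a"])
    show "norm (Z n s) \<le> norm y\<^sub>0 + K * a" if "s \<in> {0..a}" for n s
    proof -
      have "norm (Z n s - Z n 0) \<le> K * \<bar>s - 0\<bar>" by (rule Zlip) (use that a in auto)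
      also have "\<dots> \<le> K * a" using that K0 by (intro mult_left_mono) auto
      finally show ?thesis unfolding Z0 using norm_triangle_sub[of "Z n s" y\<^sub>0] by linarith
    qed
    show "\<exists>d>0. \<forall>n y. y \<in> {0..a} \<and> norm (x - y) < d \<longrightarrow> norm (Z n x - Z n y) < \<epsilon>"
      if "x \<in> {0..a}" "0 < \<epsilon>" for x \<epsilon>
    proof (intro exI conjI allI impI)
      show "\<epsilon> / (K + 1) > 0" using that K0 by simp
      fix n y assume y: "y \<in> {0..a} \<and> norm (x - y) < \<epsilon> / (K + 1)"
      have "norm (Z n x - Z n y) \<le> K * \<bar>x - y\<bar>" using y that by (intro Zlip) auto
      also have "\<dots> \<le> (K + 1) * \<bar>x - y\<bar>" by (intro mult_right_mono) auto
      also have "\<dots> < \<epsilon>" using y K0 by (simp add: pos_less_divide_eq mult.commute)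
      finally show "norm (Z n x - Z n y) < \<epsilon>" .
    qed
  qed (use that in auto)
  have lim: "(\<lambda>n. Z (k n) s) \<longlonglongrightarrow> Y s" if "s \<in> {0..a}" for s
    by (rule LIMSEQ_I) (use YZ that in meson)
  have Yint: "Y s = y\<^sub>0 + integral {0..s} (\<lambda>\<sigma>. F \<sigma> (Y \<sigma>))" if s: "s \<in> {0..a}" for s
  proof (rule LIMSEQ_unique[OF lim[OF s]])
    have A: "(\<lambda>n. integral {0..s} (\<lambda>\<sigma>. F \<sigma> (Z (k n) \<sigma>))) \<longlonglongrightarrow> integral {0..s} (\<lambda>\<sigma>. F \<sigma> (Y \<sigma>))"
    proof (rule dominated_convergence(2)[where h = "\<lambda>_. K"])
      show "(\<lambda>\<sigma>. F \<sigma> (Z (k n) \<sigma>)) integrable_on {0..s}" for n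
        by (rule Fi[OF Zc]) (use s in auto)
      show "(\<lambda>n. F \<sigma> (Z (k n) \<sigma>)) \<longlonglongrightarrow> F \<sigma> (Y \<sigma>)" if "\<sigma> \<in> {0..s}" for \<sigma>
      proof -
        have "isCont (\<lambda>(s, y). F s y) (\<sigma>, Y \<sigma>)"
          using F by (simp add: continuous_on_eq_continuous_at)
        moreover have "(\<lambda>n. (\<sigma>, Z (k n) \<sigma>)) \<longlonglongrightarrow> (\<sigma>, Y \<sigma>)"
          by (intro tendsto_intros lim) (use that s in auto)
        ultimately show ?thesis using isCont_tendsto_compose by fastforce
      qed
    qed (use K in auto)
    have B: "(\<lambda>n. integral {0..max 0 (s - e (k n))} (\<lambda>\<sigma>. F \<sigma> (Z (k n) \<sigma>))
                     - integral {0..s} (\<lambda>\<sigma>. F \<sigma> (Z (k n) \<sigma>))) \<longlonglongrightarrow> 0"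
    proof (rule Lim_null_comparison)
      show "\<forall>\<^sub>F n in sequentially. norm (integral {0..max 0 (s - e (k n))} (\<lambda>\<sigma>. F \<sigma> (Z (k n) \<sigma>))
                     - integral {0..s} (\<lambda>\<sigma>. F \<sigma> (Z (k n) \<sigma>))) \<le> K * e (k n)"
      proof (rule always_eventually, rule allI)
        fix n
        have "norm (integral {0..max 0 (s - e (k n))} (\<lambda>\<sigma>. F \<sigma> (Z (k n) \<sigma>))
                     - integral {0..s} (\<lambda>\<sigma>. F \<sigma> (Z (k n) \<sigma>))) \<le> K * \<bar>max 0 (s - e (k n)) - s\<bar>"
          by (rule step[OF Zc]) (use s e[of "k n"] in auto)
        also have "\<dots> \<le> K * e (k n)" using s e[of "k n"] by (intro mult_left_mono K0) auto
        finally show "norm (integral {0..max 0 (s - e (k n))} (\<lambda>\<sigma>. F \<sigma> (Z (k n) \<sigma>))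
                     - integral {0..s} (\<lambda>\<sigma>. F \<sigma> (Z (k n) \<sigma>))) \<le> K * e (k n)" .
      qed
      show "(\<lambda>n. K * e (k n)) \<longlonglongrightarrow> 0"
        using tendsto_mult_right_zero[OF LIMSEQ_subseq_LIMSEQ[OF e0 k]] by (simp add: o_def)
    qed
    have "(\<lambda>n. integral {0..max 0 (s - e (k n))} (\<lambda>\<sigma>. F \<sigma> (Z (k n) \<sigma>)))
        \<longlonglongrightarrow> integral {0..s} (\<lambda>\<sigma>. F \<sigma> (Y \<sigma>))"
      by (rule Lim_transform[OF A B])
    then show "(\<lambda>n. Z (k n) s) \<longlonglongrightarrow> y\<^sub>0 + integral {0..s} (\<lambda>\<sigma>. F \<sigma> (Y \<sigma>))"
      unfolding Z[OF s] by (intro tendsto_intros)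
  qed
  show ?thesis
  proof (rule that)
    show "Y 0 = y\<^sub>0" using Yint[of 0] a by simp
    fix s assume s: "s \<in> {0..a}"
    have "((\<lambda>u. y\<^sub>0 + integral {0..u} (\<lambda>\<sigma>. F \<sigma> (Y \<sigma>))) has_vector_derivative 0 + F s (Y s)) (at s within {0..a})"
      by (rule has_vector_derivative_add has_vector_derivative_const
          integral_has_vector_derivative[OF Fc[OF Yc] s])+
    then have "((\<lambda>u. y\<^sub>0 + integral {0..u} (\<lambda>\<sigma>. F \<sigma> (Y \<sigma>))) has_vector_derivative F s (Y s)) (at s within {0..a})"
      by simp
    then show "(Y has_vector_derivative F s (Y s)) (at s within {0..a})"
      by (rule has_vector_derivative_transform[OF s, rotated]) (rule Yint)
  qed
qed

section \<open>Flat charts and normal arcs\<close>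

lemma has_vector_derivative_compose:
  assumes "(f has_vector_derivative v) (at s within A)" "(g has_derivative g') (at (f s))"
  shows "((\<lambda>s. g (f s)) has_vector_derivative g' v) (at s within A)"
  using vector_derivative_diff_chain_within[OF assms(1) has_derivative_at_withinI[OF assms(2)]]
  by (simp add: o_def)

lemma difference_quotient_tendsto:
  fixes f :: "real \<Rightarrow> 'a::real_normed_vector"
  assumes "(f has_vector_derivative v) (at 0)"
  shows "((\<lambda>h. (f h - f 0) /\<^sub>R h) \<longlongrightarrow> v) (at 0)"
proof -
  have "((\<lambda>h. norm (f h - f 0 - h *\<^sub>R v) / norm h) \<longlongrightarrow> 0) (at 0)"
    using assms by (simp add: has_vector_derivative_def has_derivative_at)
  moreover have "\<forall>\<^sub>F h in at 0. norm (f h - f 0 - h *\<^sub>R v) / norm h = norm ((f h - f 0) /\<^sub>R h - v)"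
    using eventually_neq_at_within[of 0 "0::real" UNIV]
  proof eventually_elim
    case (elim h)
    then have "(f h - f 0) /\<^sub>R h - v = (f h - f 0 - h *\<^sub>R v) /\<^sub>R h"
      by (simp add: scaleR_diff_right)
    then show "norm (f h - f 0 - h *\<^sub>R v) / norm h = norm ((f h - f 0) /\<^sub>R h - v)"
      by (simp add: divide_inverse mult.commute)
  qed
  ultimately have "((\<lambda>h. norm ((f h - f 0) /\<^sub>R h - v)) \<longlongrightarrow> 0) (at 0)"
    by (rule Lim_transform_eventually)
  then show ?thesis by (simp only: tendsto_norm_zero_iff LIM_zero_iff)
qed

text \<open>The data of a chart at \<open>x\<close>, reduced to what the arcs use.  The chart is recorded through its inverse
  on a ball around \<open>\<Psi> x\<close>, so that straight segments and convex projections stay in the range of the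
  coordinates.\<close>

locale flat_chart =
  fixes S :: "'a::euclidean_space set" and x :: 'a
    and \<Psi> \<Phi> :: "'a \<Rightarrow> 'a" and D E :: "'a \<Rightarrow> 'a \<Rightarrow>\<^sub>L 'a"
    and V :: "'a set" and \<rho> :: real
  assumes radius_pos: "\<rho> > 0"
    and subspace: "subspace V"
    and base: "\<Phi> (\<Psi> x) = x"
    and open_domain: "open (\<Phi> ` ball (\<Psi> x) \<rho>)"
    and chart_inverse: "\<And>y. y \<in> ball (\<Psi> x) \<rho> \<Longrightarrow> \<Psi> (\<Phi> y) = y"
    and chart_derivative:
      "\<And>z. z \<in> \<Phi> ` ball (\<Psi> x) \<rho> \<Longrightarrow> (\<Psi> has_derivative blinfun_apply (D z)) (at z)"
    and inverse_derivative:
      "\<And>y. y \<in> ball (\<Psi> x) \<rho> \<Longrightarrow> (\<Phi> has_derivative blinfun_apply (E y)) (at y)"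
    and continuous_chart_derivative: "continuous_on (\<Phi> ` ball (\<Psi> x) \<rho>) D"
    and continuous_inverse_derivative: "continuous_on (ball (\<Psi> x) \<rho>) E"
    and flat: "\<And>y. y \<in> ball (\<Psi> x) \<rho> \<Longrightarrow> \<Phi> y \<in> S \<longleftrightarrow> y - \<Psi> x \<in> V"
begin

definition U :: "'a set" where "U = \<Phi> ` ball (\<Psi> x) \<rho>"

lemma open_U: "open U" using open_domain by (simp add: U_def)

lemma base_in_U: "x \<in> U"
  unfolding U_def using base radius_pos by (metis centre_in_ball imageI)

lemma inverse_in_U: "y \<in> ball (\<Psi> x) \<rho> \<Longrightarrow> \<Phi> y \<in> U"
  by (simp add: U_def)

lemma chart_in_ball: "z \<in> U \<Longrightarrow> \<Psi> z \<in> ball (\<Psi> x) \<rho>"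
  using chart_inverse by (force simp: U_def)

lemma inverse_chart: "z \<in> U \<Longrightarrow> \<Phi> (\<Psi> z) = z"
  using chart_inverse by (force simp: U_def)

lemma stratum_iff: "z \<in> U \<Longrightarrow> z \<in> S \<longleftrightarrow> \<Psi> z - \<Psi> x \<in> V"
  using flat[OF chart_in_ball] inverse_chart by simp

lemma base_in_stratum: "x \<in> S"
  using stratum_iff[OF base_in_U] subspace_0[OF subspace] by simp

lemma continuous_chart: "continuous_on U \<Psi>"
  unfolding U_def by (rule has_derivative_continuous_on[OF has_derivative_at_withinI[OF chart_derivative]])

lemma continuous_inverse: "continuous_on (ball (\<Psi> x) \<rho>) \<Phi>"
  by (rule has_derivative_continuous_on[OF has_derivative_at_withinI[OF inverse_derivative]])

lemma inverse_derivative_chart_derivative: "E (\<Psi> z) (D z v) = v" if z: "z \<in> U"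
proof -
  have "(\<Phi> \<circ> \<Psi> has_derivative blinfun_apply (E (\<Psi> z)) \<circ> blinfun_apply (D z)) (at z)"
    using chart_derivative[of z] inverse_derivative[OF chart_in_ball[OF z]] z
    by (intro diff_chain_at) (simp_all add: U_def)
  then have "(id has_derivative blinfun_apply (E (\<Psi> z)) \<circ> blinfun_apply (D z)) (at z)"
    by (rule has_derivative_transform_within_open[OF _ open_U z]) (simp add: inverse_chart)
  then have "blinfun_apply (E (\<Psi> z)) \<circ> blinfun_apply (D z) = (\<lambda>v. v)"
    unfolding id_def by (rule has_derivative_unique[OF _ has_derivative_ident])
  then show ?thesis by (simp add: fun_eq_iff)
qed

lemma small_neighbourhood:
  assumes "\<epsilon> > 0"
  obtains d where "d > 0" "\<And>z. dist z x < d \<Longrightarrow> z \<in> U \<and> norm (\<Psi> z - \<Psi> x) < \<epsilon>"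
proof -
  have "isCont \<Psi> x"
    using continuous_chart open_U base_in_U by (simp add: continuous_on_eq_continuous_at)
  then obtain d1 where d1: "d1 > 0" "\<And>z. dist z x < d1 \<Longrightarrow> dist (\<Psi> z) (\<Psi> x) < \<epsilon>"
    using assms unfolding continuous_at_eps_delta by metis
  obtain d2 where d2: "d2 > 0" "\<And>z. dist z x < d2 \<Longrightarrow> z \<in> U"
    using open_U base_in_U unfolding open_dist by metis
  show ?thesis
    by (rule that[of "min d1 d2"]) (use d1 d2 in \<open>auto simp: dist_norm\<close>)
qed

lemma chart_controls_distance:
  assumes "\<epsilon> > 0"
  obtains d where "d > 0" "\<And>z. z \<in> U \<Longrightarrow> norm (\<Psi> z - \<Psi> x) < d \<Longrightarrow> dist z x < \<epsilon>"
proof -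
  have "isCont \<Phi> (\<Psi> x)"
    using continuous_inverse radius_pos by (simp add: continuous_on_eq_continuous_at)
  then obtain d where d: "d > 0" "\<And>y. dist y (\<Psi> x) < d \<Longrightarrow> dist (\<Phi> y) (\<Phi> (\<Psi> x)) < \<epsilon>"
    using assms unfolding continuous_at_eps_delta by metis
  show ?thesis
    by (rule that[OF d(1)]) (metis base d(2) dist_norm inverse_chart)
qed

text \<open>A curve in \<open>S\<close> becomes a curve in the translate of \<open>V\<close>, whose velocity lies in the closed subspace
  \<open>V\<close>; conversely a straight line in the translate of \<open>V\<close> is pulled back to a curve in \<open>S\<close>.\<close>

lemma tangent_space_eq:
  assumes z: "z \<in> U" "z \<in> S"
  shows "tangent_space S z = {v. D z v \<in> V}"
proof (intro set_eqI iffI; clarify)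
  fix v assume "v \<in> tangent_space S z"
  then obtain \<gamma> \<epsilon> where \<epsilon>: "\<epsilon> > 0" and \<gamma>: "\<gamma> ` {-\<epsilon><..<\<epsilon>} \<subseteq> S" "\<gamma> 0 = z"
    "(\<gamma> has_vector_derivative v) (at 0)"
    unfolding tangent_space_def by auto
  have "(\<Psi> has_derivative blinfun_apply (D z)) (at (\<gamma> 0))"
    using chart_derivative[of z] z(1) \<gamma>(2) by (simp add: U_def)
  then have "((\<lambda>s. \<Psi> (\<gamma> s)) has_vector_derivative D z v) (at 0)"
    by (rule has_vector_derivative_compose[OF \<gamma>(3)])
  then have lim: "((\<lambda>h. (\<Psi> (\<gamma> h) - \<Psi> (\<gamma> 0)) /\<^sub>R h) \<longlongrightarrow> D z v) (at 0)"
    by (rule difference_quotient_tendsto)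
  show "D z v \<in> V"
  proof (rule Lim_in_closed_set[OF closed_subspace[OF subspace] _ _ lim])
    have "isCont \<gamma> 0" using \<gamma>(3) has_vector_derivative_continuous by blast
    then have "\<forall>\<^sub>F h in at 0. \<gamma> h \<in> U"
      using topological_tendstoD[of \<gamma> "\<gamma> 0" "at 0" U] open_U z(1) \<gamma>(2) by (simp add: isCont_def)
    moreover have "\<forall>\<^sub>F h in at 0. \<gamma> h \<in> S"
    proof -
      have "\<forall>\<^sub>F h in at (0::real). h \<in> {-\<epsilon><..<\<epsilon>}"
        using \<epsilon> by (intro eventually_at_in_open') auto
      then show ?thesis by eventually_elim (use \<gamma>(1) in auto)
    qed
    ultimately show "\<forall>\<^sub>F h in at 0. (\<Psi> (\<gamma> h) - \<Psi> (\<gamma> 0)) /\<^sub>R h \<in> V"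
    proof eventually_elim
      case (elim h)
      have "\<Psi> (\<gamma> h) - \<Psi> z = (\<Psi> (\<gamma> h) - \<Psi> x) - (\<Psi> z - \<Psi> x)" by simp
      also have "\<dots> \<in> V" using elim z stratum_iff subspace_diff[OF subspace] by blast
      finally show ?case using \<gamma>(2) by (simp add: subspace_scale[OF subspace])
    qed
  qed simp
next
  fix v assume v: "D z v \<in> V"
  define w where "w = D z v"
  have "isCont (\<lambda>s::real. \<Psi> z + s *\<^sub>R w) 0" by (intro continuous_intros)
  then have "\<forall>\<^sub>F s in at (0::real). \<Psi> z + s *\<^sub>R w \<in> ball (\<Psi> x) \<rho>"
    using topological_tendstoD[of "\<lambda>s. \<Psi> z + s *\<^sub>R w" "\<Psi> z" "at 0" "ball (\<Psi> x) \<rho>"]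
      chart_in_ball[OF z(1)] by (simp add: isCont_def)
  then obtain \<epsilon> where \<epsilon>: "\<epsilon> > 0"
    "\<And>s. s \<noteq> 0 \<Longrightarrow> dist s 0 < \<epsilon> \<Longrightarrow> \<Psi> z + s *\<^sub>R w \<in> ball (\<Psi> x) \<rho>"
    unfolding eventually_at by auto
  have ball: "\<Psi> z + s *\<^sub>R w \<in> ball (\<Psi> x) \<rho>" if "s \<in> {-\<epsilon><..<\<epsilon>}" for s
    using \<epsilon>(2)[of s] that chart_in_ball[OF z(1)] by (cases "s = 0") auto
  define \<gamma> where "\<gamma> = (\<lambda>s. \<Phi> (\<Psi> z + s *\<^sub>R w))"
  have deriv: "(\<gamma> has_vector_derivative E (\<Psi> z + s *\<^sub>R w) w) (at s)" if "s \<in> {-\<epsilon><..<\<epsilon>}" for s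
  proof -
    have "((\<lambda>s. \<Psi> z + s *\<^sub>R w) has_vector_derivative w) (at s)"
      by (auto intro!: derivative_eq_intros)
    then show ?thesis
      unfolding \<gamma>_def by (rule has_vector_derivative_compose) (rule inverse_derivative[OF ball[OF that]])
  qed
  show "v \<in> tangent_space S z"
    unfolding tangent_space_def
  proof (clarify, intro exI conjI)
    show "\<gamma> C1_differentiable_on {-\<epsilon><..<\<epsilon>}"
      unfolding C1_differentiable_on_def
    proof (intro exI conjI ballI)
      show "continuous_on {-\<epsilon><..<\<epsilon>} (\<lambda>s. E (\<Psi> z + s *\<^sub>R w) w)"
        by (intro continuous_intros continuous_on_compose2[OF continuous_inverse_derivative])
           (use ball in auto)
    qed (rule deriv)
    show "\<gamma> ` {-\<epsilon><..<\<epsilon>} \<subseteq> S"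
    proof clarify
      fix s assume s: "s \<in> {-\<epsilon><..<\<epsilon>}"
      have "\<Psi> z + s *\<^sub>R w - \<Psi> x = (\<Psi> z - \<Psi> x) + s *\<^sub>R w" by simp
      also have "\<dots> \<in> V" using z stratum_iff v
        by (auto simp: w_def intro!: subspace_add[OF subspace] subspace_scale[OF subspace])
      finally show "\<gamma> s \<in> S" using flat[OF ball[OF s]] by (simp add: \<gamma>_def)
    qed
    show "\<gamma> 0 = z" by (simp add: \<gamma>_def inverse_chart[OF z(1)])
    show "(\<gamma> has_vector_derivative v) (at 0)"
      using deriv[of 0] \<epsilon>(1) inverse_derivative_chart_derivative[OF z(1)] by (simp add: w_def)
  qed fact
qed

end

locale controlled_chart = flat_chart S x \<Psi> \<Phi> D E V \<rho>
  for S :: "'a::euclidean_space set" and x \<Psi> \<Phi> D E V \<rho> +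
  fixes T :: real and BL :: "'a \<Rightarrow> real \<Rightarrow> ('a \<times> real) set" and K \<delta> :: real
  assumes H: "H_BL T BL" and K_pos: "K > 0"
    and velocity_bound: "\<And>y t b l. t \<in> {0..T} \<Longrightarrow> (b, l) \<in> BL y t \<Longrightarrow> norm b \<le> K"
    and cost_bound: "\<And>y t b l. t \<in> {0..T} \<Longrightarrow> (b, l) \<in> BL y t \<Longrightarrow> \<bar>l\<bar> \<le> K"
    and proper: "V \<noteq> UNIV" and \<delta>_pos: "\<delta> > 0"
    and normal_velocities: "\<And>t z w. t \<in> {0..T} \<Longrightarrow> z \<in> U - S \<Longrightarrow> w \<in> orthogonal_comp V \<Longrightarrow>
      norm w < \<delta> \<Longrightarrow> \<exists>b \<in> B_of BL z t. D z b = w"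
begin

text \<open>Velocities are uniquely determined by their flat coordinates; the one with coordinates \<open>w\<close> depends
  continuously on the point.\<close>

lemma normal_velocity_lift:
  assumes "t \<in> {0..T}" "z \<in> U - S" "w \<in> orthogonal_comp V" "norm w < \<delta>"
  shows "E (\<Psi> z) w \<in> B_of BL z t"
proof -
  obtain b where "b \<in> B_of BL z t" "D z b = w" using normal_velocities[OF assms] by blast
  then show ?thesis using inverse_derivative_chart_derivative[of z b] assms(2) by auto
qed

lemma orthogonal_comp_meets_trivially: "u \<in> orthogonal_comp V \<Longrightarrow> u \<in> V \<Longrightarrow> u = 0"
  by (auto simp: orthogonal_comp_def orthogonal_self)

text \<open>Off \<open>S\<close> this is normal controllability with \<open>w = 0\<close>.  On \<open>S\<close> it follows in the limit from points off
  \<open>S\<close>, which exist arbitrarily close because \<open>V\<close> is a proper subspace.\<close>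

lemma zero_velocity:
  assumes t: "t \<in> {0..T}" and z: "z \<in> U"
  shows "0 \<in> B_of BL z t"
proof -
  have off: "0 \<in> B_of BL y t" if "y \<in> U - S" for y
    using normal_velocity_lift[OF t that, of 0] \<delta>_pos
    by (simp add: subspace_0 subspace_orthogonal_comp)
  show ?thesis
  proof (cases "z \<in> S")
    case True
    obtain u where u: "u \<in> orthogonal_comp V" "u \<noteq> 0"
    proof -
      obtain c where "c \<notin> V" using proper by blast
      moreover obtain p q where "p \<in> span V" "\<And>w. w \<in> span V \<Longrightarrow> orthogonal q w" "c = p + q"
        using orthogonal_subspace_decomp_exists[of V c] by blast
      moreover have "span V = V" using subspace by simp
      ultimately show ?thesis using that[of q]
        by (cases "q = 0") (auto simp: orthogonal_comp_def orthogonal_commute)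
    qed
    define y where "y = (\<lambda>n. \<Psi> z + (1 / real (Suc n)) *\<^sub>R u)"
    have ylim: "y \<longlonglongrightarrow> \<Psi> z"
      using tendsto_add[OF tendsto_const tendsto_scaleR[OF LIMSEQ_Suc[OF lim_1_over_n] tendsto_const], of "\<Psi> z" u]
      by (simp add: y_def)
    then have ev: "\<forall>\<^sub>F n in sequentially. y n \<in> ball (\<Psi> x) \<rho>"
      using topological_tendstoD[OF _ open_ball chart_in_ball[OF z]] by blast
    then obtain n0 where n0: "\<And>n. n \<ge> n0 \<Longrightarrow> y n \<in> ball (\<Psi> x) \<rho>"
      unfolding eventually_sequentially by blast
    have "isCont \<Phi> (\<Psi> z)"
      using continuous_inverse chart_in_ball[OF z] by (simp add: continuous_on_eq_continuous_at)
    then have "(\<lambda>n. \<Phi> (y n)) \<longlonglongrightarrow> \<Phi> (\<Psi> z)" using ylim isCont_tendsto_compose by blast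
    then have lim: "(\<lambda>n. \<Phi> (y (n + n0))) \<longlonglongrightarrow> z"
      using LIMSEQ_ignore_initial_segment[of "\<lambda>n. \<Phi> (y n)" "\<Phi> (\<Psi> z)" n0] inverse_chart[OF z] by simp
    have "0 \<in> B_of BL (\<Phi> (y (n + n0))) t" for n
    proof (rule off)
      have "y (n + n0) - \<Psi> x \<notin> V"
      proof
        assume "y (n + n0) - \<Psi> x \<in> V"
        then have "(y (n + n0) - \<Psi> x) - (\<Psi> z - \<Psi> x) \<in> V"
          using True stratum_iff[OF z] subspace_diff[OF subspace] by blast
        then have "(1 / real (Suc (n + n0))) *\<^sub>R u \<in> V" by (simp add: y_def)
        then have "real (Suc (n + n0)) *\<^sub>R (1 / real (Suc (n + n0))) *\<^sub>R u \<in> V"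
          by (rule subspace_scale[OF subspace])
        also have "real (Suc (n + n0)) *\<^sub>R (1 / real (Suc (n + n0))) *\<^sub>R u = u" by simp
        finally show False using orthogonal_comp_meets_trivially u by simp
      qed
      then show "\<Phi> (y (n + n0)) \<in> U - S" using flat[OF n0] inverse_in_U[OF n0] by simp
    qed
    then show ?thesis
      using B_of_closed_graph[OF H lim, of "\<lambda>_. t" t "\<lambda>_. 0" 0] t by simp
  qed (use off z in auto)
qed

text \<open>Staying at rest is admissible, so trajectories with bounded cost exist.\<close>

lemma value_fun_upper_bound:
  assumes t: "t \<in> {0..T}" and z: "z \<in> U" and G: "\<And>y. \<bar>g y\<bar> \<le> G"
  shows "value_fun BL g (z, t) \<le> ereal (K * T + G)"
proof -
  have "0 \<in> B_of BL z (t - s)" if "s \<in> {0..t}" for s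
    by (rule zero_velocity) (use that t z in auto)
  then obtain l where l: "l integrable_on {0..t}" "\<And>s. s \<in> {0..t} \<Longrightarrow> (0, l s) \<in> BL z (t - s)"
    using measurable_cost_selection[OF H, of t "\<lambda>_. z" "\<lambda>_. 0" t] t by auto
  have arc: "admissible_arc BL t t (\<lambda>_. z) (\<lambda>s. integral {0..s} l)"
  proof (rule admissible_arc_of_velocity[where b = "\<lambda>_. 0" and K = K])
    show "\<bar>l s\<bar> \<le> K" if "s \<in> {0..t}" for s
      by (rule cost_bound[OF _ l(2)[OF that]]) (use that t in auto)
  qed (use l K_pos in auto)
  have "\<bar>integral {0..t} l\<bar> \<le> K * t"
    by (rule admissible_arc_cost_bound[OF arc _ _ _ cost_bound]) (use t K_pos in auto)
  also have "\<dots> \<le> K * T" using t K_pos by (intro mult_left_mono) auto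
  finally have "integral {0..t} l + g z \<le> K * T + G" using G[of z] by linarith
  moreover have "value_fun BL g (z, t) \<le> ereal (integral {0..t} l + g z)"
    using value_fun_le_cost[OF arc] t by simp
  ultimately show ?thesis using order_trans ereal_less_eq(3) by blast
qed

text \<open>The segment \<open>Y s = \<Psi> z + s *\<^sub>R w\<close> with \<open>w \<in> V\<^sup>\<bottom>\<close> of norm \<open>\<delta> / 2\<close> only decreases the component of
  \<open>\<Psi> z - \<Psi> x\<close> orthogonal to \<open>V\<close>.  It stays off the stratum until that component vanishes, and its velocity is
  admissible all along, no matter which strata it passes through.\<close>

lemma normal_arc_to_stratum:
  assumes z: "z \<in> U - S" and t: "t \<le> T" and small: "2 / \<delta> * norm (\<Psi> z - \<Psi> x) \<le> t"
  obtains z' \<tau> where "z' \<in> U \<inter> S" "norm (\<Psi> z' - \<Psi> x) \<le> norm (\<Psi> z - \<Psi> x)"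
    "0 \<le> \<tau>" "\<tau> \<le> 2 / \<delta> * norm (\<Psi> z - \<Psi> x)"
    "value_fun BL g (z, t) \<le> ereal (K * \<tau>) + value_fun BL g (z', t - \<tau>)"
proof -
  obtain v u where v: "v \<in> V" and u: "u \<in> orthogonal_comp V" and dec: "\<Psi> z - \<Psi> x = v + u"
  proof -
    obtain p q where "p \<in> span V" "\<And>w. w \<in> span V \<Longrightarrow> orthogonal q w" "\<Psi> z - \<Psi> x = p + q"
      using orthogonal_subspace_decomp_exists[of V "\<Psi> z - \<Psi> x"] by blast
    moreover have "span V = V" using subspace by simp
    ultimately show ?thesis using that[of p q] by (auto simp: orthogonal_comp_def orthogonal_commute)
  qed
  have u0: "u \<noteq> 0" using z stratum_iff[of z] dec v by auto
  have ort: "orthogonal v u" using u v by (auto simp: orthogonal_comp_def)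
  have pyth: "norm (v + c *\<^sub>R u) \<le> norm (\<Psi> z - \<Psi> x)" if "0 \<le> c" "c \<le> 1" for c
  proof (rule power2_le_imp_le)
    have "(norm (v + c *\<^sub>R u))\<^sup>2 = (norm v)\<^sup>2 + c\<^sup>2 * (norm u)\<^sup>2"
      using norm_add_Pythagorean[of v "c *\<^sub>R u"] ort by (simp add: orthogonal_clauses power_mult_distrib)
    also have "\<dots> \<le> (norm v)\<^sup>2 + 1 * (norm u)\<^sup>2"
      using that by (intro add_left_mono mult_right_mono) (auto simp: power_le_one)
    also have "\<dots> = (norm (\<Psi> z - \<Psi> x))\<^sup>2" using norm_add_Pythagorean[OF ort] dec by simp
    finally show "(norm (v + c *\<^sub>R u))\<^sup>2 \<le> (norm (\<Psi> z - \<Psi> x))\<^sup>2" .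
  qed simp
  have nu: "norm u \<le> norm (\<Psi> z - \<Psi> x)"
  proof (rule power2_le_imp_le)
    show "(norm u)\<^sup>2 \<le> (norm (\<Psi> z - \<Psi> x))\<^sup>2" using norm_add_Pythagorean[OF ort] dec by simp
  qed simp
  define \<tau> where "\<tau> = 2 * norm u / \<delta>"
  have \<tau>: "0 < \<tau>" using u0 \<delta>_pos by (simp add: \<tau>_def)
  have \<tau>le: "\<tau> \<le> 2 / \<delta> * norm (\<Psi> z - \<Psi> x)"
    using nu \<delta>_pos by (simp add: \<tau>_def divide_right_mono)
  then have \<tau>t: "\<tau> \<le> t" using small by simp
  define w where "w = - (u /\<^sub>R \<tau>)"
  have w: "w \<in> orthogonal_comp V" "norm w < \<delta>"
    unfolding w_def using u u0 \<delta>_pos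
    by (auto simp: \<tau>_def subspace_orthogonal_comp subspace_neg subspace_scale divide_simps)
  define Y where "Y = (\<lambda>s. \<Psi> z + s *\<^sub>R w)"
  have Yx: "Y s - \<Psi> x = v + (1 - s / \<tau>) *\<^sub>R u" for s
    using dec by (simp add: Y_def w_def algebra_simps divide_inverse)
  have Ynorm: "norm (Y s - \<Psi> x) \<le> norm (\<Psi> z - \<Psi> x)" if "s \<in> {0..\<tau>}" for s
    unfolding Yx using pyth[of "1 - s / \<tau>"] that \<tau> by (simp add: divide_simps)
  have Yball: "Y s \<in> ball (\<Psi> x) \<rho>" if "s \<in> {0..\<tau>}" for s
    using Ynorm[OF that] chart_in_ball[of z] z by (simp add: dist_norm norm_minus_commute)
  have Ydist: "Y s - \<Psi> x \<in> V \<longleftrightarrow> s = \<tau>" for s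
  proof
    assume "Y s - \<Psi> x \<in> V"
    then have "(1 - s / \<tau>) *\<^sub>R u \<in> V"
      using subspace_diff[OF subspace _ v, of "Y s - \<Psi> x"] by (simp add: Yx)
    then have "(1 - s / \<tau>) *\<^sub>R u = 0"
      using u by (intro orthogonal_comp_meets_trivially) (simp_all add: subspace_scale subspace_orthogonal_comp)
    then show "s = \<tau>" using u0 \<tau> by simp
  qed (use v \<tau> in \<open>simp add: Yx\<close>)
  define X where "X = (\<lambda>s. \<Phi> (Y s))"
  define b where "b = (\<lambda>s. E (Y s) w)"
  have Ycont: "continuous_on {0..\<tau>} Y" unfolding Y_def by (intro continuous_intros)
  have Xcont: "continuous_on {0..\<tau>} X"
    unfolding X_def by (rule continuous_on_compose2[OF continuous_inverse Ycont]) (use Yball in auto)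
  have bcont: "continuous_on {0..\<tau>} b"
    unfolding b_def by (intro continuous_intros continuous_on_compose2[OF continuous_inverse_derivative Ycont])
      (use Yball in auto)
  have Xderiv: "(X has_vector_derivative b s) (at s within {0..\<tau>})" if "s \<in> {0..\<tau>}" for s
  proof -
    have "(Y has_vector_derivative w) (at s within {0..\<tau>})"
      unfolding Y_def by (auto intro!: derivative_eq_intros)
    then show ?thesis
      unfolding X_def b_def
      by (rule has_vector_derivative_compose) (rule inverse_derivative[OF Yball[OF that]])
  qed
  have before: "b s \<in> B_of BL (X s) (t - s)" if s: "s \<in> {0..<\<tau>}" for s
  proof -
    have "X s \<in> U - S" using flat[OF Yball, of s] Ydist[of s] s inverse_in_U[OF Yball, of s]
      by (simp add: X_def)
    then have "E (\<Psi> (X s)) w \<in> B_of BL (X s) (t - s)"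
      using s \<tau>t t by (intro normal_velocity_lift w) auto
    then show ?thesis using chart_inverse[OF Yball, of s] s by (simp add: X_def b_def)
  qed
  have mem: "b s \<in> B_of BL (X s) (t - s)" if s: "s \<in> {0..\<tau>}" for s
  proof (cases "s = \<tau>")
    case True
    \<comment> \<open>The end point lies on the stratum, where normal controllability is silent; closedness of the graph takes over.\<close>
    define r where "r = (\<lambda>n. \<tau> - \<tau> / real (Suc n))"
    have r: "r n \<in> {0..<\<tau>}" for n using \<tau> by (auto simp: r_def divide_simps)
    have "(\<lambda>n. \<tau> - \<tau> * (1 / real (Suc n))) \<longlonglongrightarrow> \<tau> - \<tau> * 0"
      by (intro tendsto_intros LIMSEQ_Suc[OF lim_1_over_n])
    then have rlim: "r \<longlonglongrightarrow> \<tau>" by (simp add: r_def)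
    have r': "r n \<in> {0..\<tau>}" for n using r[of n] by auto
    have lims: "(\<lambda>n. X (r n)) \<longlonglongrightarrow> X \<tau>" "(\<lambda>n. b (r n)) \<longlonglongrightarrow> b \<tau>"
      using Xcont bcont rlim r' \<tau> unfolding continuous_on_sequentially o_def by auto
    moreover have "(\<lambda>n. t - r n) \<longlonglongrightarrow> t - \<tau>" by (rule tendsto_diff[OF tendsto_const rlim])
    moreover have "t - r n \<in> {0..T}" for n using r[of n] \<tau>t t by auto
    ultimately have "b \<tau> \<in> B_of BL (X \<tau>) (t - \<tau>)"
      using lims before[OF r] B_of_closed_graph[OF H] by blast
    then show ?thesis unfolding True .
  qed (use before s in auto)
  obtain l where l: "l integrable_on {0..\<tau>}" "\<And>s. s \<in> {0..\<tau>} \<Longrightarrow> (b s, l s) \<in> BL (X s) (t - s)"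
    using measurable_cost_selection[OF H Xcont bcont \<tau>t t mem] by blast
  have times: "t - s \<in> {0..T}" if "s \<in> {0..\<tau>}" for s using that \<tau>t t by auto
  have arc: "admissible_arc BL t \<tau> X (\<lambda>s. integral {0..s} l)"
    by (rule admissible_arc_of_velocity[OF Xderiv l])
       (use K_pos velocity_bound[OF times l(2)] cost_bound[OF times l(2)] in auto)
  have cost: "\<bar>integral {0..\<tau>} l\<bar> \<le> K * \<tau>"
    by (rule admissible_arc_cost_bound[OF arc _ _ _ cost_bound]) (use t \<tau> \<tau>t K_pos in auto)
  have X0: "X 0 = z" using inverse_chart z by (simp add: X_def Y_def)
  have "value_fun BL g (z, t) \<le> ereal (integral {0..\<tau>} l) + value_fun BL g (X \<tau>, t - \<tau>)"
    using dynamic_programming[OF arc, of g] \<tau> \<tau>t X0 by simp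
  also have "\<dots> \<le> ereal (K * \<tau>) + value_fun BL g (X \<tau>, t - \<tau>)"
    using cost by (intro add_right_mono) auto
  finally have val: "value_fun BL g (z, t) \<le> ereal (K * \<tau>) + value_fun BL g (X \<tau>, t - \<tau>)" .
  have \<tau>in: "\<tau> \<in> {0..\<tau>}" using \<tau> by simp
  have "X \<tau> \<in> U \<inter> S"
    using flat[OF Yball[OF \<tau>in]] Ydist[of \<tau>] inverse_in_U[OF Yball[OF \<tau>in]] by (simp add: X_def)
  moreover have "norm (\<Psi> (X \<tau>) - \<Psi> x) \<le> norm (\<Psi> z - \<Psi> x)"
    using Ynorm[OF \<tau>in] chart_inverse[OF Yball[OF \<tau>in]] by (simp add: X_def)
  ultimately show ?thesis by (rule that[OF _ _ less_imp_le[OF \<tau>] \<tau>le val])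
qed

end

section \<open>Closest points in continuously varying convex sets\<close>

lemma hausdorff_dist_less_imp_near:
  assumes "hausdorff_dist A B < ennreal \<eta>"
  shows "a \<in> A \<Longrightarrow> \<exists>b\<in>B. dist a b < \<eta>" and "b \<in> B \<Longrightarrow> \<exists>a\<in>A. dist a b < \<eta>"
proof -
  have 1: "(SUP a\<in>A. INF b\<in>B. ennreal (dist a b)) < ennreal \<eta>"
    and 2: "(SUP b\<in>B. INF a\<in>A. ennreal (dist a b)) < ennreal \<eta>"
    using assms by (auto simp: hausdorff_dist_def)
  show "\<exists>b\<in>B. dist a b < \<eta>" if "a \<in> A"
  proof -
    have "(INF b\<in>B. ennreal (dist a b)) < ennreal \<eta>"
      by (rule le_less_trans[OF SUP_upper 1]) (rule that)
    then show ?thesis by (auto simp: INF_less_iff ennreal_less_iff)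
  qed
  show "\<exists>a\<in>A. dist a b < \<eta>" if "b \<in> B"
  proof -
    have "(INF a\<in>A. ennreal (dist a b)) < ennreal \<eta>"
      by (rule le_less_trans[OF SUP_upper 2]) (rule that)
    then show ?thesis by (auto simp: INF_less_iff ennreal_less_iff)
  qed
qed

text \<open>If \<open>a\<close> is the closest point of a set at Hausdorff distance less than \<open>\<eta>\<close> from \<open>A p\<close>, then some \<open>a' \<in> A p\<close>
  near \<open>a\<close> is at most \<open>2 \<eta>\<close> farther from \<open>u\<close> than the closest point \<open>a\<^sub>0\<close> of \<open>A p\<close>.  By convexity the angle
  at \<open>a\<^sub>0\<close> is obtuse, so Pythagoras bounds \<open>dist a' a\<^sub>0\<close> by a quantity that vanishes with \<open>\<eta>\<close>.\<close>

lemma continuous_on_closest_point_hausdorff: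
  fixes A :: "'p::metric_space \<Rightarrow> 'b::euclidean_space set"
  assumes A: "\<And>p. p \<in> P \<Longrightarrow> convex (A p)" "\<And>p. p \<in> P \<Longrightarrow> closed (A p)" "\<And>p. p \<in> P \<Longrightarrow> A p \<noteq> {}"
    and cont: "\<And>p. p \<in> P \<Longrightarrow> ((\<lambda>q. hausdorff_dist (A q) (A p)) \<longlongrightarrow> 0) (at p within P)"
  shows "continuous_on P (\<lambda>p. closest_point (A p) u)"
  unfolding continuous_on_def
proof (intro ballI tendstoI)
  fix p and e :: real assume p: "p \<in> P" and e: "e > 0"
  define a\<^sub>0 where "a\<^sub>0 = closest_point (A p) u"
  define d where "d = dist u a\<^sub>0"
  have a0: "a\<^sub>0 \<in> A p" unfolding a\<^sub>0_def using A p by (intro closest_point_in_set) auto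
  \<comment> \<open>The last bound is the one that makes \<open>(d + 2 \<eta>)\<^sup>2 - d\<^sup>2\<close> at most \<open>(e / 2)\<^sup>2\<close>.\<close>
  define \<eta> where "\<eta> = min 1 (min (e / 2) (e\<^sup>2 / (16 * (d + 1))))"
  have d0: "d \<ge> 0" by (simp add: d_def)
  have \<eta>: "\<eta> > 0" "\<eta> \<le> 1" using e d0 by (auto simp: \<eta>_def)
  have \<eta>e: "\<eta> \<le> e / 2" unfolding \<eta>_def by (simp only: min_le_iff_disj order_refl simp_thms)
  have "\<eta> \<le> e\<^sup>2 / (16 * (d + 1))" by (simp add: \<eta>_def)
  then have \<eta>d: "4 * \<eta> * (d + 1) \<le> (e / 2)\<^sup>2" using d0 by (simp add: pos_le_divide_eq power_divide algebra_simps)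
  have "\<forall>\<^sub>F q in at p within P. hausdorff_dist (A q) (A p) < ennreal \<eta>"
    using order_tendstoD(2)[OF cont[OF p], of "ennreal \<eta>"] \<eta> by simp
  moreover have "\<forall>\<^sub>F q in at p within P. q \<in> P" by (simp add: eventually_at_filter)
  ultimately show "\<forall>\<^sub>F q in at p within P. dist (closest_point (A q) u) (closest_point (A p) u) < e"
  proof eventually_elim
    case (elim q)
    define a where "a = closest_point (A q) u"
    have a: "a \<in> A q" unfolding a_def using A elim by (intro closest_point_in_set) auto
    obtain a' where a': "a' \<in> A p" "dist a a' < \<eta>"
      using hausdorff_dist_less_imp_near(1)[OF elim(1) a] by blast
    obtain c where c: "c \<in> A q" "dist c a\<^sub>0 < \<eta>"
      using hausdorff_dist_less_imp_near(2)[OF elim(1) a0] by blast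
    have "dist u a \<le> dist u c" unfolding a_def using A elim c by (intro closest_point_le) auto
    also have "\<dots> \<le> d + \<eta>" using dist_triangle[of u c a\<^sub>0] c(2) by (simp add: d_def dist_commute)
    finally have "dist u a' \<le> d + 2 * \<eta>" using dist_triangle[of u a' a] a'(2) by simp
    then have "(norm (u - a'))\<^sup>2 \<le> (d + 2 * \<eta>)\<^sup>2" by (intro power_mono) (simp_all add: dist_norm)
    moreover have "(norm (u - a'))\<^sup>2 = d\<^sup>2 - 2 * ((u - a\<^sub>0) \<bullet> (a' - a\<^sub>0)) + (norm (a' - a\<^sub>0))\<^sup>2"
      unfolding d_def dist_norm power2_norm_eq_inner by (simp add: inner_simps inner_commute)
    moreover have "(u - a\<^sub>0) \<bullet> (a' - a\<^sub>0) \<le> 0"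
      unfolding a\<^sub>0_def using A p a' by (intro closest_point_dot) auto
    ultimately have "(norm (a' - a\<^sub>0))\<^sup>2 \<le> (d + 2 * \<eta>)\<^sup>2 - d\<^sup>2" by linarith
    also have "\<dots> = 4 * \<eta> * (d + \<eta>)" by (simp add: power2_eq_square algebra_simps)
    also have "\<dots> \<le> 4 * \<eta> * (d + 1)" using \<eta> by (intro mult_left_mono) auto
    also have "\<dots> \<le> (e / 2)\<^sup>2" by (rule \<eta>d)
    finally have "norm (a' - a\<^sub>0) \<le> e / 2" by (rule power2_le_imp_le) (use e in simp)
    then have "dist a a\<^sub>0 < e" using dist_triangle[of a a\<^sub>0 a'] a'(2) \<eta>e by (simp add: dist_norm)
    then show ?case by (simp add: a_def a\<^sub>0_def)
  qed
qed

section \<open>The upper envelope on a stratum and arcs inside the stratum\<close>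

lemma dist_Pair_le_add: "dist (a, b) (c, d) \<le> dist a c + dist b d"
  by (simp add: dist_Pair_Pair sqrt_sum_squares_le_sum)

lemma usc_envelope_lessD:
  fixes z :: "'a::metric_space"
  assumes "usc_envelope A f z < y"
  obtains \<epsilon> where "\<epsilon> > 0" "\<And>w. w \<in> A \<Longrightarrow> dist w z < \<epsilon> \<Longrightarrow> f w < y"
proof -
  have "\<forall>\<^sub>F w in inf (nhds z) (principal A). f w < y"
    by (rule Limsup_lessD) (use assms in \<open>simp add: usc_envelope_def\<close>)
  then show ?thesis
    using that unfolding eventually_inf_principal eventually_nhds_metric by blast
qed

lemma usc_envelope_leI:
  fixes z :: "'a::metric_space"
  assumes "\<And>y. c < ereal y \<Longrightarrow> \<exists>\<epsilon>>0. \<forall>w\<in>A. dist w z < \<epsilon> \<longrightarrow> f w \<le> ereal y"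
  shows "usc_envelope A f z \<le> c"
proof (rule ccontr)
  assume "\<not> usc_envelope A f z \<le> c"
  then have "c < usc_envelope A f z" by simp
  from ereal_dense2[OF this] obtain y where y: "c < ereal y" "ereal y < usc_envelope A f z"
    by blast
  obtain \<epsilon> where "\<epsilon> > 0" "\<forall>w\<in>A. dist w z < \<epsilon> \<longrightarrow> f w \<le> ereal y"
    using assms[OF y(1)] by blast
  then have "\<forall>\<^sub>F w in inf (nhds z) (principal A). f w \<le> ereal y"
    unfolding eventually_inf_principal eventually_nhds_metric by blast
  then have "usc_envelope A f z \<le> ereal y" unfolding usc_envelope_def by (rule Limsup_bounded)
  then show False using y(2) by simp
qed

lemma usc_envelope_upper:
  fixes z :: "'a::metric_space"
  assumes "z \<in> A"
  shows "f z \<le> usc_envelope A f z"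
proof (rule ccontr)
  assume "\<not> f z \<le> usc_envelope A f z"
  then have "usc_envelope A f z < f z" by simp
  then obtain \<epsilon> where "\<epsilon> > 0" "\<And>w. w \<in> A \<Longrightarrow> dist w z < \<epsilon> \<Longrightarrow> f w < f z"
    using usc_envelope_lessD by blast
  from this(2)[OF assms] this(1) show False by simp
qed

lemma usc_envelope_mono_set:
  fixes z :: "'a::metric_space"
  assumes "A \<subseteq> B"
  shows "usc_envelope A f z \<le> usc_envelope B f z"
proof (rule usc_envelope_leI)
  fix y assume "usc_envelope B f z < ereal y"
  then obtain \<epsilon> where "\<epsilon> > 0" "\<And>w. w \<in> B \<Longrightarrow> dist w z < \<epsilon> \<Longrightarrow> f w < ereal y"
    using usc_envelope_lessD by blast
  then show "\<exists>\<epsilon>>0. \<forall>w\<in>A. dist w z < \<epsilon> \<longrightarrow> f w \<le> ereal y"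
    using assms by (meson less_imp_le subsetD)
qed

context controlled_chart begin

text \<open>Only the comparison of points off \<open>S\<close> with points on \<open>S\<close> has content: a normal arc leads from
  \<open>(z, s)\<close> to a point \<open>(z', s - \<tau>)\<close> over the stratum, still close to \<open>(x, t)\<close>, at a cost at most \<open>K \<tau>\<close>.\<close>

lemma usc_envelope_stratum:
  assumes t: "t \<in> {0<..T}"
  shows "usc_envelope (UNIV \<times> {0<..T}) (value_fun BL g) (x, t)
    = usc_envelope (S \<times> {0<..T}) (value_fun BL g) (x, t)"
proof (rule antisym)
  show "usc_envelope (S \<times> {0<..T}) (value_fun BL g) (x, t)
      \<le> usc_envelope (UNIV \<times> {0<..T}) (value_fun BL g) (x, t)"
    by (rule usc_envelope_mono_set) auto
  show "usc_envelope (UNIV \<times> {0<..T}) (value_fun BL g) (x, t)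
      \<le> usc_envelope (S \<times> {0<..T}) (value_fun BL g) (x, t)" (is "_ \<le> ?c")
  proof (rule usc_envelope_leI)
    fix y assume "?c < ereal y"
    then obtain y' where y': "?c < ereal y'" "ereal y' < ereal y" using ereal_dense2 by blast
    obtain \<epsilon> where \<epsilon>: "\<epsilon> > 0"
      "\<And>w. w \<in> S \<times> {0<..T} \<Longrightarrow> dist w (x, t) < \<epsilon> \<Longrightarrow> value_fun BL g w < ereal y'"
      using usc_envelope_lessD[OF y'(1)] by blast
    obtain d1 where d1: "d1 > 0" "\<And>z. z \<in> U \<Longrightarrow> norm (\<Psi> z - \<Psi> x) < d1 \<Longrightarrow> dist z x < \<epsilon> / 2"
      using chart_controls_distance[of "\<epsilon> / 2"] \<epsilon>(1) by auto
    \<comment> \<open>A bound for the crossing time: it keeps the end point near \<open>(x, t)\<close> and at a positive time, and the cost below the gap between \<open>y'\<close> and \<open>y\<close>.\<close>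
    define \<mu> where "\<mu> = min (\<epsilon> / 4) (min (t / 4) ((y - y') / K))"
    have \<mu>: "\<mu> > 0" using \<epsilon>(1) t y'(2) K_pos by (simp add: \<mu>_def)
    have "\<mu> \<le> (y - y') / K" unfolding \<mu>_def by (simp only: min_le_iff_disj order_refl simp_thms)
    then have \<mu>K: "K * \<mu> \<le> y - y'" using K_pos by (simp add: pos_le_divide_eq mult.commute)
    have \<mu>\<epsilon>: "\<mu> \<le> \<epsilon> / 4" and \<mu>t: "\<mu> \<le> t / 4"
      unfolding \<mu>_def by (simp_all only: min_le_iff_disj order_refl simp_thms)
    have "min d1 (\<delta> / 2 * \<mu>) > 0" using d1(1) \<mu> \<delta>_pos by simp
    then obtain d2 where d2: "d2 > 0"
      "\<And>z. dist z x < d2 \<Longrightarrow> z \<in> U \<and> norm (\<Psi> z - \<Psi> x) < min d1 (\<delta> / 2 * \<mu>)"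
      using small_neighbourhood by blast
    show "\<exists>\<epsilon>'>0. \<forall>w\<in>UNIV \<times> {0<..T}. dist w (x, t) < \<epsilon>' \<longrightarrow> value_fun BL g w \<le> ereal y"
    proof (intro exI conjI ballI impI)
      show "min d2 (min (\<epsilon> / 4) (t / 2)) > 0" using d2(1) \<epsilon>(1) t by simp
      fix w assume w: "w \<in> UNIV \<times> {0<..T}" "dist w (x, t) < min d2 (min (\<epsilon> / 4) (t / 2))"
      obtain z s where zs: "w = (z, s)" by (cases w)
      have dz: "dist z x < d2" and ds: "\<bar>s - t\<bar> < \<epsilon> / 4" "\<bar>s - t\<bar> < t / 2"
        using w(2) dist_fst_le[of w "(x, t)"] dist_snd_le[of w "(x, t)"]
        by (simp_all add: zs dist_real_def)
      have s: "0 < s" "s \<le> T" using w(1) by (simp_all add: zs)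
      have zU: "z \<in> U" and zd: "norm (\<Psi> z - \<Psi> x) < d1" "norm (\<Psi> z - \<Psi> x) < \<delta> / 2 * \<mu>"
        using d2(2)[OF dz] by simp_all
      show "value_fun BL g w \<le> ereal y"
      proof (cases "z \<in> S")
        case True
        have "value_fun BL g w < ereal y'"
          by (rule \<epsilon>(2)) (use True w \<epsilon>(1) in \<open>auto simp: zs\<close>)
        then show ?thesis using y'(2) by (meson less_imp_le less_trans)
      next
        case False
        have st: "t / 2 < s" using ds(2) by linarith
        have small: "2 / \<delta> * norm (\<Psi> z - \<Psi> x) < \<mu>"
          using zd(2) \<delta>_pos by (simp add: field_simps)
        then have "2 / \<delta> * norm (\<Psi> z - \<Psi> x) \<le> s" using \<mu>t st \<mu> by linarith
        then obtain z' \<tau> where z': "z' \<in> U \<inter> S" "norm (\<Psi> z' - \<Psi> x) \<le> norm (\<Psi> z - \<Psi> x)"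
          "0 \<le> \<tau>" "\<tau> \<le> 2 / \<delta> * norm (\<Psi> z - \<Psi> x)"
          "value_fun BL g (z, s) \<le> ereal (K * \<tau>) + value_fun BL g (z', s - \<tau>)"
          using normal_arc_to_stratum[of z s g] False zU s by blast
        have \<tau>: "\<tau> < \<mu>" using z'(4) small by simp
        have "dist z' x < \<epsilon> / 2" using d1(2)[of z'] z'(1,2) zd(1) by simp
        moreover have "dist (s - \<tau>) t < \<epsilon> / 2"
          unfolding dist_real_def using ds(1) \<tau> \<mu>\<epsilon> z'(3) by linarith
        ultimately have "dist (z', s - \<tau>) (x, t) < \<epsilon>"
          using dist_Pair_le_add[of z' "s - \<tau>" x t] by linarith
        moreover have "0 < s - \<tau>" "s - \<tau> \<le> T" using s z'(3) \<tau> \<mu>t st \<mu> by linarith+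
        ultimately have "value_fun BL g (z', s - \<tau>) < ereal y'"
          using \<epsilon>(2)[of "(z', s - \<tau>)"] z'(1) by simp
        then have "value_fun BL g (z, s) \<le> ereal (K * \<tau>) + ereal y'"
          using z'(5) by (meson add_left_mono less_imp_le order_trans)
        moreover have "K * \<tau> \<le> K * \<mu>" using \<tau> K_pos by (intro mult_left_mono) auto
        then have "ereal (K * \<tau>) + ereal y' \<le> ereal y" using \<mu>K by simp
        ultimately show ?thesis unfolding zs by (rule order_trans)
      qed
    qed
  qed
qed

lemma usc_envelope_finite:
  assumes t: "t \<in> {0<..T}" and G: "\<And>y. \<bar>g y\<bar> \<le> G"
  obtains u where "usc_envelope (UNIV \<times> {0<..T}) (value_fun BL g) (x, t) = ereal u"
proof -
  have "ereal (- (K * T) - G) \<le> value_fun BL g (x, t)"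
    by (rule value_fun_lower_bound[OF _ cost_bound]) (use t G K_pos in auto)
  also have "\<dots> \<le> usc_envelope (UNIV \<times> {0<..T}) (value_fun BL g) (x, t)"
    by (rule usc_envelope_upper) (use t in simp)
  finally have lower: "ereal (- (K * T) - G) \<le> usc_envelope (UNIV \<times> {0<..T}) (value_fun BL g) (x, t)" .
  have upper: "usc_envelope (UNIV \<times> {0<..T}) (value_fun BL g) (x, t) \<le> ereal (K * T + G)"
  proof (rule usc_envelope_leI)
    fix y assume y: "ereal (K * T + G) < ereal y"
    obtain d where d: "d > 0" "\<And>z. dist z x < d \<Longrightarrow> z \<in> U \<and> norm (\<Psi> z - \<Psi> x) < 1"
      by (rule small_neighbourhood[OF zero_less_one]) blast
    have "value_fun BL g w \<le> ereal y" if w: "w \<in> UNIV \<times> {0<..T}" "dist w (x, t) < d" for w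
    proof -
      have "fst w \<in> U" using d(2)[of "fst w"] dist_fst_le[of w "(x, t)"] w(2) by simp
      moreover have "snd w \<in> {0..T}" using w(1) by (auto simp: mem_Times_iff)
      ultimately have "value_fun BL g (fst w, snd w) \<le> ereal (K * T + G)"
        using value_fun_upper_bound G by blast
      also have "\<dots> \<le> ereal y" using y by (rule less_imp_le)
      finally show ?thesis by simp
    qed
    then show "\<exists>\<epsilon>>0. \<forall>w\<in>UNIV \<times> {0<..T}. dist w (x, t) < \<epsilon> \<longrightarrow> value_fun BL g w \<le> ereal y"
      using d(1) by blast
  qed
  show ?thesis
    using lower upper that by (cases "usc_envelope (UNIV \<times> {0<..T}) (value_fun BL g) (x, t)") auto
qed

end

locale adapted_chart = controlled_chart S x \<Psi> \<Phi> D E V \<rho> T BL K \<delta>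
  for S :: "'a::euclidean_space set" and x \<Psi> \<Phi> D E V \<rho> T BL K \<delta> +
  assumes tangential_continuity: "\<And>z t. z \<in> S \<Longrightarrow> t \<in> {0..T} \<Longrightarrow>
    ((\<lambda>(y, s). hausdorff_dist (tangential_BL BL S y s) (tangential_BL BL S z t)) \<longlongrightarrow> 0)
      (at (z, t) within S \<times> {0..T})"
begin

text \<open>A selection of the tangential velocities and costs that follows \<open>q\<close> as closely as possible.  It takes
  the value \<open>q\<close> wherever \<open>q\<close> is itself tangential and admissible.\<close>

definition nearest :: "'a \<times> real \<Rightarrow> 'a \<Rightarrow> real \<Rightarrow> 'a \<times> real" where
  "nearest q z t = closest_point (tangential_BL BL S z t) q"

lemma tangential_BL_eq:
  assumes "z \<in> U \<inter> S"
  shows "tangential_BL BL S z t = BL z t \<inter> {q. D z (fst q) \<in> V}"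
  using tangent_space_eq assms by (auto simp: tangential_BL_def)

lemma tangential_BL_properties:
  assumes z: "z \<in> U \<inter> S" and t: "t \<in> {0..T}"
  shows "convex (tangential_BL BL S z t)" "closed (tangential_BL BL S z t)"
    "tangential_BL BL S z t \<noteq> {}"
proof -
  have BL: "compact (BL z t)" "convex (BL z t)" using H t unfolding H_BL_def by simp_all
  have bl: "bounded_linear (\<lambda>q :: 'a \<times> real. D z (fst q))"
    by (rule bounded_linear_compose[OF blinfun.bounded_linear_right bounded_linear_fst])
  have "convex {q :: 'a \<times> real. D z (fst q) \<in> V}"
    using convex_linear_vimage[OF bounded_linear.linear[OF bl] subspace_imp_convex[OF subspace]] by (simp add: vimage_def)
  then show "convex (tangential_BL BL S z t)"
    unfolding tangential_BL_eq[OF z] using BL(2) by (rule convex_Int[rotated])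
  have "closed ((\<lambda>q :: 'a \<times> real. D z (fst q)) -` V)"
    by (intro continuous_closed_vimage closed_subspace subspace linear_continuous_at bl)
  then show "closed (tangential_BL BL S z t)"
    unfolding tangential_BL_eq[OF z] using compact_imp_closed[OF BL(1)]
    by (intro closed_Int) (simp_all add: vimage_def)
  obtain l where "(0, l) \<in> BL z t" using zero_velocity[OF t] z by (auto simp: B_of_def)
  then show "tangential_BL BL S z t \<noteq> {}"
    unfolding tangential_BL_eq[OF z] using subspace_0[OF subspace] by (auto simp: blinfun.zero_right)
qed

lemma nearest_in:
  assumes "z \<in> U \<inter> S" "t \<in> {0..T}"
  shows "nearest q z t \<in> BL z t" "D z (fst (nearest q z t)) \<in> V"
  using closest_point_in_set[OF tangential_BL_properties(2,3)[OF assms]]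
  by (auto simp: nearest_def tangential_BL_eq[OF assms(1)])

lemma nearest_self: "q \<in> tangential_BL BL S z t \<Longrightarrow> nearest q z t = q"
  by (simp add: nearest_def closest_point_self)

lemma continuous_on_nearest:
  "continuous_on ((U \<inter> S) \<times> {0..T}) (\<lambda>p. nearest q (fst p) (snd p))"
  unfolding nearest_def
proof (rule continuous_on_closest_point_hausdorff)
  fix p assume p: "p \<in> (U \<inter> S) \<times> {0..T}"
  then show "convex (tangential_BL BL S (fst p) (snd p))" "closed (tangential_BL BL S (fst p) (snd p))"
    "tangential_BL BL S (fst p) (snd p) \<noteq> {}"
    using tangential_BL_properties[of "fst p" "snd p"] by (auto simp: mem_Times_iff)
  have "((\<lambda>q. hausdorff_dist (tangential_BL BL S (fst q) (snd q))
      (tangential_BL BL S (fst p) (snd p))) \<longlongrightarrow> 0) (at (fst p, snd p) within S \<times> {0..T})"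
    using tangential_continuity[of "fst p" "snd p"] p by (simp add: case_prod_beta' mem_Times_iff)
  then show "((\<lambda>q. hausdorff_dist (tangential_BL BL S (fst q) (snd q))
      (tangential_BL BL S (fst p) (snd p))) \<longlongrightarrow> 0) (at p within (U \<inter> S) \<times> {0..T})"
    unfolding prod.collapse by (rule tendsto_within_subset) auto
qed

text \<open>In the chart, \<open>nearest\<close> is a continuous vector field with values in \<open>V\<close> on a compact convex part \<open>C\<close> of the
  translate of \<open>V\<close>.  Composing with the projections onto \<open>C\<close> and onto \<open>[0, T]\<close> extends it to a bounded
  continuous field \<open>F\<close> on the whole space, to which Peano's theorem applies; the solutions do not leave \<open>C\<close>
  for a short time, so there the extension does not matter.\<close>

lemma stratum_arcs:
  obtains a where "a > 0" "\<And>z t h. z \<in> U \<inter> S \<Longrightarrow> norm (\<Psi> z - \<Psi> x) < \<rho> / 4 \<Longrightarrow>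
    0 \<le> h \<Longrightarrow> h \<le> a \<Longrightarrow> h \<le> t \<Longrightarrow> t \<le> T \<Longrightarrow> \<exists>X L. admissible_arc BL t h X L \<and> X 0 = z \<and>
      (\<forall>s\<in>{0..h}. X s \<in> U \<inter> S \<and>
        (X has_vector_derivative fst (nearest q (X s) (t - s))) (at s within {0..h})) \<and>
      ((\<lambda>s. snd (nearest q (X s) (t - s))) has_integral L h) {0..h}"
proof -
  define C where "C = cball (\<Psi> x) (\<rho> / 2) \<inter> (+) (\<Psi> x) ` V"
  have C_iff: "y \<in> C \<longleftrightarrow> norm (y - \<Psi> x) \<le> \<rho> / 2 \<and> y - \<Psi> x \<in> V" for y
    by (force simp: C_def dist_norm norm_minus_commute image_iff)
  have C: "compact C" "convex C" "C \<noteq> {}"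
  proof -
    have "closed ((+) (\<Psi> x) ` V)" by (intro closed_translation closed_subspace subspace)
    then show "compact C" unfolding C_def by (intro compact_Int_closed compact_cball)
    show "convex C" unfolding C_def
      by (intro convex_Int convex_cball convex_translation subspace_imp_convex subspace)
    show "C \<noteq> {}" using C_iff[of "\<Psi> x"] radius_pos subspace_0[OF subspace] by auto
  qed
  have CU: "\<Phi> y \<in> U \<inter> S" "y \<in> ball (\<Psi> x) \<rho>" if "y \<in> C" for y
  proof -
    show b: "y \<in> ball (\<Psi> x) \<rho>"
      using that radius_pos by (simp add: C_iff dist_norm norm_minus_commute)
    show "\<Phi> y \<in> U \<inter> S" using flat[OF b] inverse_in_U[OF b] that by (simp add: C_iff)
  qed
  define P where "P = closest_point C"
  have P: "P y \<in> C" for y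
    unfolding P_def using C compact_imp_closed by (intro closest_point_in_set) auto
  have Pid: "P y = y" if "y \<in> C" for y unfolding P_def by (rule closest_point_self[OF that])
  have Pc: "continuous_on A P" for A
    unfolding P_def using C compact_imp_closed by (intro continuous_on_closest_point) auto
  define G where "G = (\<lambda>p. D (\<Phi> (fst p)) (fst (nearest q (\<Phi> (fst p)) (snd p))))"
  have \<Phi>c: "continuous_on (C \<times> {0..T}) (\<lambda>p. \<Phi> (fst p))"
    by (rule continuous_on_compose2[OF continuous_inverse continuous_on_fst[OF continuous_on_id]])
       (use CU in auto)
  have Dc: "continuous_on (C \<times> {0..T}) (\<lambda>p. D (\<Phi> (fst p)))"
    by (rule continuous_on_compose2[OF continuous_chart_derivative[folded U_def] \<Phi>c]) (use CU in auto)
  have "continuous_on (C \<times> {0..T}) (\<lambda>p. (\<Phi> (fst p), snd p))"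
    by (intro continuous_on_Pair \<Phi>c continuous_on_snd continuous_on_id)
  then have "continuous_on (C \<times> {0..T}) (\<lambda>p. nearest q (fst (\<Phi> (fst p), snd p)) (snd (\<Phi> (fst p), snd p)))"
    by (rule continuous_on_compose2[OF continuous_on_nearest]) (use CU in auto)
  then have Gc: "continuous_on (C \<times> {0..T}) G"
    unfolding G_def by (intro blinfun.continuous_on Dc continuous_on_fst) simp
  then have "compact (G ` (C \<times> {0..T}))"
    by (intro compact_continuous_image compact_Times C compact_Icc)
  then obtain B where B: "B > 0" "\<And>p. p \<in> C \<times> {0..T} \<Longrightarrow> norm (G p) \<le> B"
    using compact_imp_bounded bounded_pos by (metis image_eqI)
  show ?thesis
  proof (rule that[of "\<rho> / (4 * B)"])
    \<comment> \<open>Starting within \<open>\<rho> / 4\<close> of the centre, with speed at most \<open>B\<close>, a solution stays within \<open>\<rho> / 2\<close> up to this time.\<close>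
    show "\<rho> / (4 * B) > 0" using radius_pos B by simp
    fix z t h assume z: "z \<in> U \<inter> S" "norm (\<Psi> z - \<Psi> x) < \<rho> / 4"
      and h: "0 \<le> h" "h \<le> \<rho> / (4 * B)" "h \<le> t" "t \<le> T"
    define F where "F = (\<lambda>s y. G (P y, max 0 (min T (t - s))))"
    have dom: "(P y, max 0 (min T (t - s))) \<in> C \<times> {0..T}" for s y using P h by auto
    have Fc: "continuous_on UNIV (\<lambda>(s, y). F s y)"
    proof -
      have "continuous_on UNIV (\<lambda>p :: real \<times> 'a. P (snd p))"
        by (rule continuous_on_compose2[OF Pc[of UNIV]]) (auto intro: continuous_on_snd)
      then have "continuous_on UNIV (\<lambda>p :: real \<times> 'a. (P (snd p), max 0 (min T (t - fst p))))"
        by (intro continuous_intros)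
      then have "continuous_on UNIV (\<lambda>p :: real \<times> 'a. G (P (snd p), max 0 (min T (t - fst p))))"
        by (rule continuous_on_compose2[OF Gc]) (use dom in auto)
      then show ?thesis by (simp add: F_def case_prod_beta')
    qed
    have FB: "norm (F s y) \<le> B" for s y unfolding F_def using B(2) dom by blast
    obtain Y where Y0: "Y 0 = \<Psi> z"
      and Yd: "\<And>s. s \<in> {0..h} \<Longrightarrow> (Y has_vector_derivative F s (Y s)) (at s within {0..h})"
      using peano_existence[OF Fc h(1) FB, of "\<Psi> z"] by blast
    have FV: "F s y \<in> V" for s y
      unfolding F_def G_def using nearest_in(2)[OF CU(1)[OF P]] dom[of y s] by simp
    have YC: "Y s \<in> C" if s: "s \<in> {0..h}" for s
    proof -
      have "norm (Y s - Y 0) \<le> B * norm (s - 0)"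
      proof (rule differentiable_bound)
        show "convex {0..h}" by simp
        show "(Y has_derivative (\<lambda>r. r *\<^sub>R F u (Y u))) (at u within {0..h})" if "u \<in> {0..h}" for u
          using Yd[OF that] by (simp add: has_vector_derivative_def)
        show "onorm (\<lambda>r. r *\<^sub>R F u (Y u)) \<le> B" if "u \<in> {0..h}" for u
          using FB[of u "Y u"] by (intro onorm_le) (simp add: mult.commute[of B] mult_left_mono)
      qed (use s h in auto)
      also have "\<dots> \<le> B * (\<rho> / (4 * B))" using s h B by (intro mult_left_mono) auto
      also have "\<dots> = \<rho> / 4" using B by simp
      finally have "norm (Y s - \<Psi> x) \<le> \<rho> / 2"
        using z(2) norm_triangle_ineq[of "Y s - Y 0" "\<Psi> z - \<Psi> x"] by (simp add: Y0)
      moreover have "Y s - \<Psi> x \<in> V"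
      proof -
        \<comment> \<open>A solution with velocity in \<open>V\<close> has constant components orthogonal to \<open>V\<close>.\<close>
        have "(Y s - \<Psi> x) \<bullet> w = 0" if w: "w \<in> orthogonal_comp V" for w
        proof -
          have orth: "v \<bullet> w = 0" if "v \<in> V" for v
            using w that by (auto simp: orthogonal_comp_def orthogonal_def)
          obtain c where "\<And>s. s \<in> {0..h} \<Longrightarrow> Y s \<bullet> w = c"
          proof (rule has_vector_derivative_zero_constant[of "{0..h}" "\<lambda>s. Y s \<bullet> w"])
            show "((\<lambda>s. Y s \<bullet> w) has_vector_derivative 0) (at u within {0..h})" if "u \<in> {0..h}" for u
              using bounded_linear.has_vector_derivative[OF bounded_linear_inner_left Yd[OF that], of w]
              by (simp add: orth[OF FV])
          qed auto
          then have "Y s \<bullet> w = Y 0 \<bullet> w" using s h(1) by simp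
          moreover have "(\<Psi> z - \<Psi> x) \<bullet> w = 0" using z(1) stratum_iff[of z] orth by simp
          ultimately show ?thesis by (simp add: Y0 inner_diff_left)
        qed
        then have "Y s - \<Psi> x \<in> orthogonal_comp (orthogonal_comp V)"
          by (auto simp: orthogonal_comp_def orthogonal_def inner_commute)
        then show ?thesis using orthogonal_comp_self[OF subspace] by simp
      qed
      ultimately show ?thesis by (simp add: C_iff)
    qed
    define X where "X = (\<lambda>s. \<Phi> (Y s))"
    define n where "n = (\<lambda>s. nearest q (X s) (t - s))"
    have XU: "X s \<in> U \<inter> S" if "s \<in> {0..h}" for s unfolding X_def by (rule CU(1)[OF YC[OF that]])
    have time: "t - s \<in> {0..T}" if "s \<in> {0..h}" for s using that h by auto
    have Feq: "F s (Y s) = D (X s) (fst (n s))" if "s \<in> {0..h}" for s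
      using time[OF that] Pid[OF YC[OF that]] by (simp add: F_def G_def X_def n_def)
    have Xd: "(X has_vector_derivative fst (n s)) (at s within {0..h})" if s: "s \<in> {0..h}" for s
    proof -
      have "(X has_vector_derivative E (Y s) (F s (Y s))) (at s within {0..h})"
        unfolding X_def
        by (rule has_vector_derivative_compose[OF Yd[OF s] inverse_derivative[OF CU(2)[OF YC[OF s]]]])
      moreover have "E (Y s) (F s (Y s)) = fst (n s)"
        using inverse_derivative_chart_derivative[of "X s"] XU[OF s] chart_inverse[OF CU(2)[OF YC[OF s]]]
        by (simp add: Feq[OF s]) (simp add: X_def)
      ultimately show ?thesis by simp
    qed
    have "continuous_on {0..h} X"
      unfolding continuous_on_eq_continuous_within using Xd has_vector_derivative_continuous by blast
    then have "continuous_on {0..h} (\<lambda>s. (X s, t - s))" by (intro continuous_intros)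
    then have "continuous_on {0..h} (\<lambda>s. nearest q (fst (X s, t - s)) (snd (X s, t - s)))"
      by (rule continuous_on_compose2[OF continuous_on_nearest]) (use XU time in auto)
    then have nc: "continuous_on {0..h} (\<lambda>s. snd (n s))" unfolding n_def by (auto intro: continuous_on_snd)
    then have ni: "(\<lambda>s. snd (n s)) integrable_on {0..h}" by (rule integrable_continuous_real)
    have nBL: "(fst (n s), snd (n s)) \<in> BL (X s) (t - s)" if "s \<in> {0..h}" for s
      using nearest_in(1)[OF XU[OF that] time[OF that]] by (simp add: n_def)
    have arc: "admissible_arc BL t h X (\<lambda>s. integral {0..s} (\<lambda>s. snd (n s)))"
      by (rule admissible_arc_of_velocity[OF Xd ni nBL])
         (use K_pos velocity_bound[OF time nBL] cost_bound[OF time nBL] in auto)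
    show "\<exists>X L. admissible_arc BL t h X L \<and> X 0 = z \<and>
      (\<forall>s\<in>{0..h}. X s \<in> U \<inter> S \<and>
        (X has_vector_derivative fst (nearest q (X s) (t - s))) (at s within {0..h})) \<and>
      ((\<lambda>s. snd (nearest q (X s) (t - s))) has_integral L h) {0..h}"
    proof (intro exI conjI ballI)
      show "X 0 = z" using inverse_chart z(1) by (simp add: X_def Y0)
      show "((\<lambda>s. snd (nearest q (X s) (t - s))) has_integral integral {0..h} (\<lambda>s. snd (n s))) {0..h}"
        using integrable_integral[OF ni] by (simp add: n_def)
    qed (use arc XU Xd in \<open>auto simp: n_def\<close>)
  qed
qed

text \<open>Every error below is at most a constant times \<open>\<eta> h\<close>: the starting point is taken within \<open>\<eta> h\<close> of
  \<open>(x, t)\<close> and its value within \<open>\<eta> h\<close> of the envelope, and for small \<open>h\<close> the velocity and cost along the arc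
  are within \<open>\<eta>\<close> of \<open>(b, l)\<close>.  Dividing by \<open>h\<close> and letting \<open>\<eta>\<close> tend to \<open>0\<close> gives the claim.\<close>

lemma subsolution_at_base:
  assumes t: "t \<in> {0<..<T}" and G: "\<And>y. \<bar>g y\<bar> \<le> G"
    and grad: "GDERIV \<phi> (x, t) :> (p, c)"
    and max: "local_max_on (S \<times> {0<..<T})
      (\<lambda>z. usc_envelope (UNIV \<times> {0<..T}) (value_fun BL g) z - ereal (\<phi> z)) (x, t)"
    and bl: "(b, l) \<in> tangential_BL BL S x t"
  shows "c - p \<bullet> b - l \<le> 0"
proof (rule stratum_arcs[of "(b, l)"])
  fix a :: real assume a: "a > 0" and arcs: "\<And>z t h. z \<in> U \<inter> S \<Longrightarrow> norm (\<Psi> z - \<Psi> x) < \<rho> / 4 \<Longrightarrow>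
      0 \<le> h \<Longrightarrow> h \<le> a \<Longrightarrow> h \<le> t \<Longrightarrow> t \<le> T \<Longrightarrow> \<exists>X L. admissible_arc BL t h X L \<and> X 0 = z \<and>
        (\<forall>s\<in>{0..h}. X s \<in> U \<inter> S \<and>
          (X has_vector_derivative fst (nearest (b, l) (X s) (t - s))) (at s within {0..h})) \<and>
        ((\<lambda>s. snd (nearest (b, l) (X s) (t - s))) has_integral L h) {0..h}"
  define W where "W = usc_envelope (UNIV \<times> {0<..T}) (value_fun BL g)"
  have t': "t \<in> {0<..T}" using t by simp
  have "\<exists>u. W (x, t) = ereal u"
    unfolding W_def by (rule usc_envelope_finite[OF t' G]) (rule exI)
  then obtain u where u: "W (x, t) = ereal u" by blast
  have "c - p \<bullet> b - l \<le> \<eta> * (3 * norm (p, c) + K + 5)" if \<eta>: "0 < \<eta>" "\<eta> \<le> 1" for \<eta>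
  proof -
    have hyp: "(x, t) \<in> (U \<inter> S) \<times> {0..T}" using base_in_U base_in_stratum t by simp
    obtain \<epsilon>1 where \<epsilon>1: "\<epsilon>1 > 0" "\<And>z s. z \<in> U \<inter> S \<Longrightarrow> s \<in> {0..T} \<Longrightarrow>
        dist (z, s) (x, t) < \<epsilon>1 \<Longrightarrow> dist (nearest (b, l) z s) (b, l) < \<eta>"
    proof -
      obtain \<epsilon>1 where e: "\<epsilon>1 > 0" "\<forall>w\<in>(U \<inter> S) \<times> {0..T}. dist w (x, t) < \<epsilon>1 \<longrightarrow>
          dist (nearest (b, l) (fst w) (snd w)) (nearest (b, l) (fst (x, t)) (snd (x, t))) < \<eta>"
        using bspec[OF continuous_on_nearest[of "(b, l)", unfolded continuous_on_iff] hyp] \<eta>(1) by blast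
      have "dist (nearest (b, l) z s) (b, l) < \<eta>"
        if "z \<in> U \<inter> S" "s \<in> {0..T}" "dist (z, s) (x, t) < \<epsilon>1" for z s
        using e(2)[rule_format, of "(z, s)"] that nearest_self[OF bl] by simp
      then show thesis using that e(1) by blast
    qed
    obtain \<epsilon>2 where \<epsilon>2: "\<epsilon>2 > 0" "\<And>w. norm (w - (x, t)) < \<epsilon>2 \<Longrightarrow>
        norm (\<phi> w - \<phi> (x, t) - (w - (x, t)) \<bullet> (p, c)) \<le> \<eta> * norm (w - (x, t))"
      using grad[unfolded gderiv_def has_derivative_at_alt, THEN conjunct2, rule_format, OF \<eta>(1)] by blast
    obtain \<epsilon>3 where \<epsilon>3: "\<epsilon>3 > 0" "\<And>w. w \<in> S \<times> {0<..<T} \<Longrightarrow> dist w (x, t) < \<epsilon>3 \<Longrightarrow>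
        W w \<le> ereal (u - \<phi> (x, t) + \<phi> w)"
    proof -
      have "\<forall>\<^sub>F w in at (x, t) within S \<times> {0<..<T}. W w - ereal (\<phi> w) \<le> W (x, t) - ereal (\<phi> (x, t))"
        using max unfolding local_max_on_def W_def by blast
      then obtain d where d: "d > 0" "\<forall>w\<in>S \<times> {0<..<T}. w \<noteq> (x, t) \<and> dist w (x, t) < d \<longrightarrow>
          W w - ereal (\<phi> w) \<le> W (x, t) - ereal (\<phi> (x, t))"
        unfolding eventually_at by blast
      have "W w \<le> ereal (u - \<phi> (x, t) + \<phi> w)" if "w \<in> S \<times> {0<..<T}" "dist w (x, t) < d" for w
      proof (cases "w = (x, t)")
        case False
        then have "W w - ereal (\<phi> w) \<le> ereal (u - \<phi> (x, t))" using bspec[OF d(2) that(1)] that(2) u by simp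
        then show ?thesis by (simp add: ereal_minus_le)
      qed (simp add: u)
      then show thesis using that d(1) by blast
    qed
    obtain \<epsilon>4 where \<epsilon>4: "\<epsilon>4 > 0" "\<And>z. dist z x < \<epsilon>4 \<Longrightarrow> z \<in> U \<and> norm (\<Psi> z - \<Psi> x) < \<rho> / 4"
    proof -
      have "\<rho> / 4 > 0" using radius_pos by simp
      then show thesis by (rule small_neighbourhood) (use that in blast)
    qed
    define \<epsilon> where "\<epsilon> = Min {\<epsilon>1, \<epsilon>2, \<epsilon>3}"
    have \<epsilon>: "\<epsilon> > 0" "\<epsilon> \<le> \<epsilon>1" "\<epsilon> \<le> \<epsilon>2" "\<epsilon> \<le> \<epsilon>3" using \<epsilon>1(1) \<epsilon>2(1) \<epsilon>3(1) by (simp_all add: \<epsilon>_def)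
    \<comment> \<open>The duration must keep the arc in the domain of the chart and all its points within \<open>\<epsilon>\<close> of \<open>(x, t)\<close>, at times in \<open>(0, T)\<close>.\<close>
    define Q where "Q = {a, \<epsilon>4, t / 3, T - t, \<epsilon> / (2 * (K + 3))}"
    define h where "h = Min Q"
    have hQ: "h \<le> v" if "v \<in> Q" for v
      unfolding h_def by (rule Min_le) (use that in \<open>simp_all add: Q_def\<close>)
    have "0 < h"
      using a \<epsilon>4(1) \<epsilon>(1) t K_pos by (simp add: h_def Q_def)
    moreover have "h \<le> a" "h \<le> \<epsilon>4" "h \<le> t / 3" "h \<le> T - t" "h \<le> \<epsilon> / (2 * (K + 3))"
      by (rule hQ, simp add: Q_def)+
    ultimately have h: "h > 0" "h \<le> a" "h \<le> \<epsilon>4" "h \<le> t / 3" "h \<le> T - t" "h \<le> \<epsilon> / (2 * (K + 3))" .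
    have h\<epsilon>: "(K + 3) * h < \<epsilon>"
      using h(6) \<epsilon>(1) K_pos by (simp add: pos_le_divide_eq algebra_simps)
    have \<eta>h: "0 < \<eta> * h" "\<eta> * h \<le> h" using \<eta> h(1) by simp_all
    \<comment> \<open>Since both envelopes agree, \<open>U\<^sup>*(x, t)\<close> is approached by values of \<open>U\<close> at points of the stratum.\<close>
    obtain z s\<^sub>0 where z: "z \<in> S" "dist (z, s\<^sub>0) (x, t) < \<eta> * h" "s\<^sub>0 \<in> {0<..T}"
      and zval: "ereal (u - \<eta> * h) < value_fun BL g (z, s\<^sub>0)"
    proof -
      have "\<not> usc_envelope (S \<times> {0<..T}) (value_fun BL g) (x, t) \<le> ereal (u - \<eta> * h)"
        using usc_envelope_stratum[OF t', of g] u \<eta>h(1) by (simp add: W_def)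
      then obtain w where "w \<in> S \<times> {0<..T}" "dist w (x, t) < \<eta> * h"
        "\<not> value_fun BL g w \<le> ereal (u - \<eta> * h)"
        using usc_envelope_leI[of "ereal (u - \<eta> * h)" "S \<times> {0<..T}" "(x, t)" "value_fun BL g"] \<eta>h(1)
        by (meson order_trans less_imp_le)
      then show thesis using that[of "fst w" "snd w"] by (auto simp: mem_Times_iff not_le)
    qed
    have dz: "norm (z - x) < \<eta> * h" and ds: "\<bar>s\<^sub>0 - t\<bar> < \<eta> * h"
      using z(2) dist_fst_le[of "(z, s\<^sub>0)" "(x, t)"] dist_snd_le[of "(z, s\<^sub>0)" "(x, t)"]
      by (simp_all add: dist_norm)
    have zU: "z \<in> U" "norm (\<Psi> z - \<Psi> x) < \<rho> / 4"
      using \<epsilon>4(2)[of z] dz \<eta>h(2) h(3) by (simp_all add: dist_norm)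
    have hs: "h < s\<^sub>0" using ds \<eta>h(2) h(1,4) by linarith
    obtain X L where arc: "admissible_arc BL s\<^sub>0 h X L" "X 0 = z"
      and X: "\<And>s. s \<in> {0..h} \<Longrightarrow> X s \<in> U \<inter> S"
        "\<And>s. s \<in> {0..h} \<Longrightarrow> (X has_vector_derivative fst (nearest (b, l) (X s) (s\<^sub>0 - s))) (at s within {0..h})"
      and L: "((\<lambda>s. snd (nearest (b, l) (X s) (s\<^sub>0 - s))) has_integral L h) {0..h}"
      using arcs[of z h s\<^sub>0] zU z(1,3) h(1,2) hs by auto
    define n where "n = (\<lambda>s. nearest (b, l) (X s) (s\<^sub>0 - s))"
    have time: "s\<^sub>0 - s \<in> {0..T}" if "s \<in> {0..h}" for s using that hs z(3) by auto
    have nK: "norm (fst (n s)) \<le> K" if "s \<in> {0..h}" for s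
      using velocity_bound[OF time[OF that], of "fst (n s)" "snd (n s)" "X s"]
        nearest_in(1)[OF X(1)[OF that] time[OF that]] by (simp add: n_def)
    have travel: "norm (X s - x) \<le> (K + 1) * h" if s: "s \<in> {0..h}" for s
    proof -
      have "norm (X s - X 0) \<le> K * norm (s - 0)"
      proof (rule differentiable_bound)
        show "(X has_derivative (\<lambda>r. r *\<^sub>R fst (n v))) (at v within {0..h})" if "v \<in> {0..h}" for v
          using X(2)[OF that] by (simp add: has_vector_derivative_def n_def)
        show "onorm (\<lambda>r. r *\<^sub>R fst (n v)) \<le> K" if "v \<in> {0..h}" for v
          using nK[OF that] by (intro onorm_le) (simp add: mult.commute[of K] mult_left_mono)
      qed (use s h in auto)
      also have "\<dots> \<le> K * h" using s K_pos by simp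
      finally show ?thesis
        using dz \<eta>h(2) norm_triangle_ineq[of "X s - X 0" "z - x"] arc(2) by (simp add: algebra_simps)
    qed
    have close: "dist (X s, s\<^sub>0 - s) (x, t) \<le> (K + 3) * h" if s: "s \<in> {0..h}" for s
    proof -
      have "dist (X s, s\<^sub>0 - s) (x, t) \<le> dist (X s) x + dist (s\<^sub>0 - s) t" by (rule dist_Pair_le_add)
      also have "dist (s\<^sub>0 - s) t \<le> 2 * h" using ds \<eta>h(2) s by (simp add: dist_real_def abs_le_iff abs_less_iff)
      finally show ?thesis using travel[OF s] by (simp add: dist_norm algebra_simps)
    qed
    have n\<eta>: "dist (n s) (b, l) < \<eta>" if s: "s \<in> {0..h}" for s
      unfolding n_def using close[OF s] h\<epsilon> \<epsilon>(2) by (intro \<epsilon>1(2) X(1) time s) simp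
    have n1: "norm (fst (n s) - b) \<le> \<eta>" and n2: "snd (n s) \<le> l + \<eta>" if s: "s \<in> {0..h}" for s
      using n\<eta>[OF s] dist_fst_le[of "n s" "(b, l)"] dist_snd_le[of "n s" "(b, l)"]
      by (simp_all add: dist_norm abs_le_iff)
    have hin: "h \<in> {0..h}" using h(1) by simp
    have displacement: "norm (X h - z - h *\<^sub>R b) \<le> \<eta> * h"
    proof -
      have "norm ((X h - h *\<^sub>R b) - (X 0 - 0 *\<^sub>R b)) \<le> \<eta> * norm (h - 0)"
      proof (rule differentiable_bound[of "{0..h}" "\<lambda>s. X s - s *\<^sub>R b"])
        show "((\<lambda>s. X s - s *\<^sub>R b) has_derivative (\<lambda>r. r *\<^sub>R (fst (n v) - b))) (at v within {0..h})"
          if "v \<in> {0..h}" for v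
          using X(2)[OF that] unfolding has_vector_derivative_def[symmetric] n_def
          by (auto intro!: derivative_eq_intros)
        show "onorm (\<lambda>r. r *\<^sub>R (fst (n v) - b)) \<le> \<eta>" if "v \<in> {0..h}" for v
          using n1[OF that] by (intro onorm_le) (simp add: mult.commute[of \<eta>] mult_left_mono)
      qed (use h in auto)
      then show ?thesis using arc(2) h(1) by (simp add: algebra_simps)
    qed
    have cost: "L h \<le> (l + \<eta>) * h"
    proof -
      have "((\<lambda>_. l + \<eta>) has_integral (l + \<eta>) * h) {0..h}"
        using has_integral_const_real[of "l + \<eta>" 0 h] h(1) by (simp add: mult.commute)
      then show ?thesis using n2 by (intro has_integral_le[OF L]) (simp_all add: n_def)
    qed
    define w where "w = (X h, s\<^sub>0 - h)"
    have wS: "w \<in> S \<times> {0<..<T}" using X(1)[OF hin] hs ds \<eta>h(2) h(1,5) z(3) by (auto simp: w_def)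
    have wclose: "norm (w - (x, t)) \<le> (K + 3) * h" using close[OF hin] by (simp add: w_def dist_norm)
    have w_dir: "norm (w - (x, t) - h *\<^sub>R (b, - 1)) \<le> 3 * (\<eta> * h)"
    proof -
      have "w - (x, t) - h *\<^sub>R (b, - 1) = (X h - x - h *\<^sub>R b, s\<^sub>0 - t)" by (simp add: w_def)
      then have "norm (w - (x, t) - h *\<^sub>R (b, - 1)) \<le> norm (X h - x - h *\<^sub>R b) + \<bar>s\<^sub>0 - t\<bar>"
        using norm_Pair_le[of "X h - x - h *\<^sub>R b" "s\<^sub>0 - t"] by simp
      also have "norm (X h - x - h *\<^sub>R b) \<le> norm (X h - z - h *\<^sub>R b) + norm (z - x)"
        using norm_triangle_ineq[of "X h - z - h *\<^sub>R b" "z - x"] by (simp add: algebra_simps)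
      finally show ?thesis using displacement dz ds by linarith
    qed
    have "ereal (u - \<eta> * h) < ereal (L h) + value_fun BL g w"
      using dynamic_programming[OF arc(1), of g] h(1) hs zval arc(2) less_le_trans by (simp add: w_def)
    also have "\<dots> \<le> ereal (L h) + W w"
      unfolding W_def using wS by (intro add_left_mono usc_envelope_upper) auto
    also have "\<dots> \<le> ereal (L h) + ereal (u - \<phi> (x, t) + \<phi> w)"
      using wclose h\<epsilon> \<epsilon>(4) by (intro add_left_mono \<epsilon>3(2) wS) (simp add: dist_norm)
    finally have main: "\<phi> (x, t) - \<phi> w \<le> (l + \<eta>) * h + \<eta> * h" using cost by simp
    have "\<phi> w - \<phi> (x, t) - (w - (x, t)) \<bullet> (p, c) \<le> \<eta> * norm (w - (x, t))"
      using \<epsilon>2(2)[of w] wclose h\<epsilon> \<epsilon>(3) by (simp add: abs_le_iff)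
    also have "\<dots> \<le> \<eta> * ((K + 3) * h)" using wclose \<eta>(1) by (intro mult_left_mono) auto
    finally have taylor: "\<phi> w - \<phi> (x, t) \<le> (w - (x, t)) \<bullet> (p, c) + \<eta> * ((K + 3) * h)" by simp
    have "(w - (x, t) - h *\<^sub>R (b, - 1)) \<bullet> (p, c) \<le> norm (w - (x, t) - h *\<^sub>R (b, - 1)) * norm (p, c)"
      by (rule norm_cauchy_schwarz)
    also have "\<dots> \<le> 3 * (\<eta> * h) * norm (p, c)" using w_dir by (intro mult_right_mono) auto
    finally have "(w - (x, t)) \<bullet> (p, c) \<le> h * (p \<bullet> b - c) + 3 * (\<eta> * h) * norm (p, c)"
      by (simp add: inner_diff_left inner_commute algebra_simps)
    then have "h * (c - p \<bullet> b - l) \<le> h * (\<eta> * (3 * norm (p, c) + K + 5))"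
      using main taylor by (simp add: algebra_simps)
    then show ?thesis using h(1) by simp
  qed
  note bound = this
  have "((\<lambda>\<eta>. \<eta> * (3 * norm (p, c) + K + 5)) \<longlongrightarrow> 0 * (3 * norm (p, c) + K + 5)) (at_right 0)"
    by (intro tendsto_intros)
  then have "((\<lambda>\<eta>. \<eta> * (3 * norm (p, c) + K + 5)) \<longlongrightarrow> 0) (at_right 0)" by simp
  then show "c - p \<bullet> b - l \<le> 0"
  proof (rule tendsto_lowerbound)
    show "\<forall>\<^sub>F \<eta> in at_right 0. c - p \<bullet> b - l \<le> \<eta> * (3 * norm (p, c) + K + 5)"
      unfolding eventually_at_right_field using bound by (intro exI[of _ 1]) auto
  qed simp
qed

end

section \<open>The theorem on regular stratifications\<close>

text \<open>The radius is reduced so that the ball lies both in the range of the chart and where the stratum is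
  flat; in flat coordinates the velocities of \<open>BL\<close> are images under the derivative of the chart.\<close>

lemma exists_controlled_chart:
  fixes BL :: "'a::euclidean_space \<Rightarrow> real \<Rightarrow> ('a \<times> real) set"
  assumes H: "H_BL T BL" and TC_NC: "TC_NC_BL T M BL" and k: "k < DIM('a)" and x: "x \<in> M k"
  shows "\<exists>\<Psi> \<Phi> D E V \<rho> K \<delta>. controlled_chart (M k) x \<Psi> \<Phi> D E V \<rho> T BL K \<delta>"
proof -
  obtain R \<Psi> where chart: "strat_chart M x R \<Psi>"
    and NC: "AFS_TC_NC T (\<Psi> ` ball x R) (rectified_strat \<Psi> (ball x R) M) (rectified_BL \<Psi> (ball x R) BL)"
    using TC_NC[unfolded TC_NC_BL_def, rule_format, of x] by blast
  define A where "A = ball x R"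
  define \<Phi> where "\<Phi> = inv_into A \<Psi>"
  have R: "R > 0" and coords: "C11_change_of_coordinates A \<Psi>"
    using chart by (simp_all add: strat_chart_def A_def)
  have open_A: "open A" and open_image: "open (\<Psi> ` A)" and inj: "inj_on \<Psi> A"
    and C11: "C11_on A \<Psi>" "C11_on (\<Psi> ` A) \<Phi>"
    using coords by (simp_all add: C11_change_of_coordinates_def \<Phi>_def)
  obtain D :: "'a \<Rightarrow> 'a \<Rightarrow>\<^sub>L 'a" and C where D: "\<forall>z\<in>A. (\<Psi> has_derivative blinfun_apply (D z)) (at z)"
    and DC: "C-lipschitz_on A D"
    using C11(1) unfolding C11_on_def by (elim exE conjE)
  obtain E :: "'a \<Rightarrow> 'a \<Rightarrow>\<^sub>L 'a" and C' where
    E: "\<forall>y\<in>\<Psi> ` A. (\<Phi> has_derivative blinfun_apply (E y)) (at y)" and EC: "C'-lipschitz_on (\<Psi> ` A) E"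
    using C11(2) unfolding C11_on_def by (elim exE conjE)
  have xA: "x \<in> A" using R by (simp add: A_def)
  have \<Phi>\<Psi>: "\<Phi> (\<Psi> z) = z" if "z \<in> A" for z unfolding \<Phi>_def by (rule inv_into_f_f[OF inj that])
  have \<Psi>x: "\<Psi> x \<in> rectified_strat \<Psi> A M k" using x xA by (simp add: rectified_strat_def)
  obtain r V \<delta> where flat: "flat_at (rectified_strat \<Psi> A M) k (\<Psi> x) r V" and \<delta>: "\<delta> > 0"
    and nc: "NC_BL_at T (\<Psi> ` A) (rectified_strat \<Psi> A M) (rectified_BL \<Psi> A BL) k (\<Psi> x) r V \<delta>"
    using NC[folded A_def, unfolded AFS_TC_NC_def, rule_format, OF less_imp_le[OF k] \<Psi>x] by blast
  have r: "r > 0" and V: "subspace V" "dim V = k" and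
    plane: "ball (\<Psi> x) r \<inter> rectified_strat \<Psi> A M k = ball (\<Psi> x) r \<inter> (\<lambda>v. \<Psi> x + v) ` V"
    using flat by (simp_all add: flat_at_def)
  obtain r' where r': "r' > 0" "ball (\<Psi> x) r' \<subseteq> \<Psi> ` A"
    using open_image xA open_contains_ball by (metis imageI)
  define \<rho> where "\<rho> = min r r'"
  have \<rho>: "\<rho> > 0" using r r' by (simp add: \<rho>_def)
  have ball_r: "ball (\<Psi> x) \<rho> \<subseteq> ball (\<Psi> x) r" and ball_A: "ball (\<Psi> x) \<rho> \<subseteq> \<Psi> ` A"
    using r'(2) by (auto simp: \<rho>_def)
  have \<Phi>A: "\<Phi> y \<in> A" "\<Psi> (\<Phi> y) = y" if "y \<in> ball (\<Psi> x) \<rho>" for y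
    using that ball_A by (auto simp: \<Phi>_def inv_into_into f_inv_into_f subsetD)
  have image: "\<Phi> ` ball (\<Psi> x) \<rho> = A \<inter> \<Psi> -` ball (\<Psi> x) \<rho>"
    using \<Phi>A \<Phi>\<Psi> by force
  have "continuous_on A \<Psi>"
    by (rule has_derivative_continuous_on[OF has_derivative_at_withinI]) (use D in blast)
  then have open_U: "open (\<Phi> ` ball (\<Psi> x) \<rho>)"
    unfolding image by (rule continuous_open_preimage[OF _ open_A open_ball])
  have in_stratum: "y \<in> rectified_strat \<Psi> A M k \<longleftrightarrow> \<Phi> y \<in> M k" if "y \<in> ball (\<Psi> x) \<rho>" for y
    using \<Phi>A[OF that] \<Phi>\<Psi> by (force simp: rectified_strat_def)
  interpret flat_chart "M k" x \<Psi> \<Phi> D E V \<rho>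
  proof
    show "\<rho> > 0" "subspace V" "open (\<Phi> ` ball (\<Psi> x) \<rho>)" by fact+
    show "\<Phi> (\<Psi> x) = x" by (rule \<Phi>\<Psi>[OF xA])
    show "\<Psi> (\<Phi> y) = y" if "y \<in> ball (\<Psi> x) \<rho>" for y by (rule \<Phi>A(2)[OF that])
    show "(\<Psi> has_derivative blinfun_apply (D z)) (at z)" if "z \<in> \<Phi> ` ball (\<Psi> x) \<rho>" for z
      using that \<Phi>A(1) D by blast
    show "(\<Phi> has_derivative blinfun_apply (E y)) (at y)" if "y \<in> ball (\<Psi> x) \<rho>" for y
      using that ball_A E by blast
    show "continuous_on (\<Phi> ` ball (\<Psi> x) \<rho>) D"
      by (rule continuous_on_subset[OF lipschitz_on_continuous_on[OF DC]]) (use \<Phi>A(1) in blast)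
    show "continuous_on (ball (\<Psi> x) \<rho>) E"
      by (rule continuous_on_subset[OF lipschitz_on_continuous_on[OF EC] ball_A])
    show "\<Phi> y \<in> M k \<longleftrightarrow> y - \<Psi> x \<in> V" if y: "y \<in> ball (\<Psi> x) \<rho>" for y
    proof -
      have "\<Phi> y \<in> M k \<longleftrightarrow> y \<in> ball (\<Psi> x) r \<inter> rectified_strat \<Psi> A M k"
        using in_stratum[OF y] ball_r y by blast
      also have "\<dots> \<longleftrightarrow> y \<in> (\<lambda>v. \<Psi> x + v) ` V" unfolding plane using ball_r y by blast
      also have "\<dots> \<longleftrightarrow> y - \<Psi> x \<in> V" by (force simp: image_iff)
      finally show ?thesis .
    qed
  qed
  obtain K where K: "K > 0" "\<And>x t b l. t \<in> {0..T} \<Longrightarrow> (b, l) \<in> BL x t \<Longrightarrow> norm b \<le> K"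
    "\<And>x t b l. t \<in> {0..T} \<Longrightarrow> (b, l) \<in> BL x t \<Longrightarrow> \<bar>l\<bar> \<le> K"
    by (rule H_BL_bound[OF H]) blast
  have "controlled_chart (M k) x \<Psi> \<Phi> D E V \<rho> T BL K \<delta>"
  proof
    show "V \<noteq> UNIV" using V(2) k by auto
    fix t z w assume t: "t \<in> {0..T}" and z: "z \<in> U - M k"
      and w: "w \<in> orthogonal_comp V" "norm w < \<delta>"
    have zA: "z \<in> A" using z image by (auto simp: U_def)
    have \<Psi>z: "\<Psi> z \<in> ball (\<Psi> x) \<rho>" using z chart_in_ball by blast
    have "\<Psi> z \<in> (ball (\<Psi> x) r \<inter> \<Psi> ` A) - rectified_strat \<Psi> A M k"
      using \<Psi>z ball_r ball_A in_stratum[OF \<Psi>z] \<Phi>\<Psi>[OF zA] z by auto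
    then have "ball 0 \<delta> \<inter> orthogonal_comp V \<subseteq> B_of (rectified_BL \<Psi> A BL) (\<Psi> z) t"
      using nc[unfolded NC_BL_at_def, rule_format, OF k t] by blast
    then have "w \<in> B_of (rectified_BL \<Psi> A BL) (\<Psi> z) t" using w by auto
    then obtain b l where bl: "w = frechet_derivative \<Psi> (at z) b" "(b, l) \<in> BL z t"
      using \<Phi>\<Psi>[OF zA] by (auto simp: B_of_def rectified_BL_def Let_def \<Phi>_def)
    have "frechet_derivative \<Psi> (at z) = blinfun_apply (D z)"
      using frechet_derivative_at[of \<Psi> "blinfun_apply (D z)" z] D zA by auto
    then show "\<exists>b\<in>B_of BL z t. D z b = w" using bl by (auto simp: B_of_def)
  qed (use H K \<delta> in auto)
  then show ?thesis by blast
qed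

theorem theorem4p1:
  fixes T :: real
    and BL :: "'a::euclidean_space \<Rightarrow> real \<Rightarrow> ('a \<times> real) set"
    and M :: "nat \<Rightarrow> 'a set"
    and g :: "'a \<Rightarrow> real"
  assumes "T > 0"
    and "H_BL T BL"
    and "regular_stratification M"
    and "adapted T M BL"
    and "TC_NC_BL T M BL"
    and "bounded (range g)"
    and "uniformly_continuous_on UNIV g"
  shows "(\<forall>k<DIM('a). \<forall>x\<in>M k. \<forall>t\<in>{0<..T}.
            usc_envelope (UNIV \<times> {0<..T}) (value_fun BL g) (x, t) =
            usc_envelope (M k \<times> {0<..T}) (value_fun BL g) (x, t)) \<and>
         (\<forall>k<DIM('a). subsolution_on T (M k) (tangential_hamiltonian BL (M k)) (value_fun BL g))"
proof (intro conjI allI impI ballI)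
  fix k x t assume k: "k < DIM('a)" and x: "x \<in> M k" and t: "t \<in> {0<..T}"
  obtain \<Psi> \<Phi> D E V \<rho> K \<delta> where "controlled_chart (M k) x \<Psi> \<Phi> D E V \<rho> T BL K \<delta>"
    using exists_controlled_chart[OF assms(2,5) k x] by blast
  then show "usc_envelope (UNIV \<times> {0<..T}) (value_fun BL g) (x, t)
      = usc_envelope (M k \<times> {0<..T}) (value_fun BL g) (x, t)"
    using t by (rule controlled_chart.usc_envelope_stratum)
next
  fix k assume k: "k < DIM('a)"
  obtain G where G: "\<And>y. \<bar>g y\<bar> \<le> G"
    using assms(6) by (auto simp: bounded_iff)
  show "subsolution_on T (M k) (tangential_hamiltonian BL (M k)) (value_fun BL g)"
    unfolding subsolution_on_def
  proof (intro allI impI; elim conjE)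
    fix \<phi> D\<phi> \<phi>t x t
    assume \<phi>: "C1_with_derivs (UNIV \<times> {0<..<T}) \<phi> D\<phi> \<phi>t"
      and max: "local_max_on (M k \<times> {0<..<T})
          (\<lambda>z. usc_envelope (UNIV \<times> {0<..T}) (value_fun BL g) z - ereal (\<phi> z)) (x, t)"
    have xt: "x \<in> M k" "t \<in> {0<..<T}" using max by (simp_all add: local_max_on_def)
    have grad: "GDERIV \<phi> (x, t) :> (D\<phi> (x, t), \<phi>t (x, t))"
      using \<phi> xt(2) by (simp add: C1_with_derivs_def)
    obtain \<Psi> \<Phi> D E V \<rho> K \<delta> where "controlled_chart (M k) x \<Psi> \<Phi> D E V \<rho> T BL K \<delta>"
      using exists_controlled_chart[OF assms(2,5) k xt(1)] by blast
    then interpret controlled_chart "M k" x \<Psi> \<Phi> D E V \<rho> T BL K \<delta> .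
    interpret adapted_chart "M k" x \<Psi> \<Phi> D E V \<rho> T BL K \<delta>
      by unfold_locales
         (use assms(4)[unfolded adapted_def, rule_format, OF less_imp_le[OF k]] in blast)
    have "tangential_hamiltonian BL (M k) x t (D\<phi> (x, t)) \<le> ereal (- \<phi>t (x, t))"
      unfolding tangential_hamiltonian_def
    proof (rule SUP_least)
      fix q assume q: "q \<in> tangential_BL BL (M k) x t"
      obtain b l where bl: "q = (b, l)" by (cases q)
      have "\<phi>t (x, t) - D\<phi> (x, t) \<bullet> b - l \<le> 0"
        by (rule subsolution_at_base[OF xt(2) G grad max]) (use q bl in simp)
      then show "(case q of (b, l) \<Rightarrow> ereal (- (b \<bullet> D\<phi> (x, t)) - l)) \<le> ereal (- \<phi>t (x, t))"
        by (simp add: bl inner_commute)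
    qed
    then have "ereal (\<phi>t (x, t)) + tangential_hamiltonian BL (M k) x t (D\<phi> (x, t))
        \<le> ereal (\<phi>t (x, t)) + ereal (- \<phi>t (x, t))" by (rule add_left_mono)
    then show "ereal (\<phi>t (x, t)) + tangential_hamiltonian BL (M k) x t (D\<phi> (x, t)) \<le> 0"
      by (simp add: zero_ereal_def)
  qed
qed

end
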